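(* Let $\nu$ be a probability measure on $\mathcal{C}_E$, different from $\mathbf{W}_{(0,0)}$. Suppose that for every $s\ge0$ the restriction of $\nu$ to $\mathcal{F}_s$ has a density with respect to the restriction of $\mathbf{W}_{(0,0)}$ to $\mathcal{F}_s$, and that this density is of the form $$g(s,X_s,N_s)=h(s)\,f_{N_s}(X_s),$$ with $f_m\in\mathcal{C}^2(\mathbf{R}_+)$ and $f_0(0)=f_m(0)=1$ for all $m\in E$, and $h\in\mathcal{C}^1(\mathbf{R}_+)$. Then there exists $\beta>0$ such that $h(s)=e^{-s\beta^2/2}$ for all $s\ge0$, and $\nu$ is a linear combination with nonnegative coefficients of the measures ${}^{(\alpha^{(m)},0)}\mathbf{W}^{(\infty)}$, $m\in E$, where for each $m\in E$ the family $\alpha^{(m)}\in\mathbf{R}^E$ is given by $\alpha^{(m)}_{m'}=\beta$ if $m'=m$ and $\alpha^{(m)}_{m'}=0$ otherwise.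
   Context: $(E,\mu)$ is a fixed finite probability space with $\mu_m:=\mu(\{m\})>0$ for all $m\in E$. Let $\mathbf{R}_E=\{(0,0)\}\cup(\mathbf{R}_+^*\times E)$ with the distance $d((x,k),(y,l))=|x-y|\mathbf{1}_{k=l}+(x+y)\mathbf{1}_{k\ne l}$ (a finite union of half-lines glued at the origin $(0,0)$, at which the index is by convention $0$). $\mathcal{C}_E$ is the set of continuous functions from $\mathbf{R}_+$ to $\mathbf{R}_E$, with canonical process $(A_t=(X_t,N_t))_{t\ge0}$; $\mathcal{F}_t$ is the $\sigma$-algebra generated by $(A_s)_{0\le s\le t}$, and $\mathcal{C}_E$ is equipped with the $\sigma$-algebra $\mathcal{F}_\infty$ generated by all $\mathcal{F}_s$, $s\ge 0$. For $(x,k)\in\mathbf{R}_E$, $\mathbf{W}_{(x,k)}$ is the law on $\mathcal{C}_E$ of the Brownian spider (Walsh Brownian motion) started at $(x,k)$: the Feller process with semigroup, for bounded Borel $f$ and $t>0$, $$P_tf(x,k)=2\sum_{m\in E}\mu_m\int_{\mathbf{R}_+^*}p_t(x+y)f(y,m)\,dy+\int_{\mathbf{R}_+^*}(p_t(x-y)-p_t(x+y))f(y,k)\,dy,\qquad p_t(a)=\frac{1}{\sqrt{2\pi t}}e^{-a^2/2t}.$$ $\mathbf{W}_{(x,k)}[\cdot]$ also denotes expectation. For $\alpha\in\mathbf{R}^E$ and $t\ge0$, let $${}^{(\alpha,0)}\mathbf{W}^{(t)}=\frac{\exp(\alpha_{N_t}X_t)}{\mathbf{W}_{(0,0)}[\exp(\alpha_{N_t}X_t)]}\cdot\mathbf{W}_{(0,0)}$$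 (with $\alpha_{N_t}X_t=0$ when $X_t=0$). ${}^{(\alpha,0)}\mathbf{W}^{(\infty)}$ denotes the (existing and unique) probability measure on $\mathcal{F}_\infty$ such that ${}^{(\alpha,0)}\mathbf{W}^{(t)}(\Lambda_s)\to{}^{(\alpha,0)}\mathbf{W}^{(\infty)}(\Lambda_s)$ as $t\to\infty$ for every $s\ge0$ and $\Lambda_s\in\mathcal{F}_s$. *)

theory Defs
  imports "HOL-Probability.Probability"
begin

text \<open>The state space. The finite index set \<open>E\<close> is the type \<open>'e\<close>; the extra index \<open>0\<close> carried by the
  junction point is \<open>None\<close>.\<close>

typedef 'e spider = "insert (0, None) ({0<..} \<times> range Some) :: (real \<times> 'e option) set"
  by blast

definition radius :: "'e spider \<Rightarrow> real" where
  "radius a = fst (Rep_spider a)"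

definition leg :: "'e spider \<Rightarrow> 'e option" where
  "leg a = snd (Rep_spider a)"

definition junction :: "'e spider" where
  "junction = Abs_spider (0, None)"

text \<open>Meaningful only for \<open>y > 0\<close>.\<close>

definition on_leg :: "real \<Rightarrow> 'e \<Rightarrow> 'e spider" where
  "on_leg y m = Abs_spider (y, Some m)"

lemma radius_nonneg: "0 \<le> radius a"
  using Rep_spider[of a] by (auto simp: radius_def)

lemma radius_eq_0_iff: "radius a = 0 \<longleftrightarrow> leg a = None"
  using Rep_spider[of a] by (auto simp: radius_def leg_def)

lemma spider_eqI: "radius a = radius b \<Longrightarrow> leg a = leg b \<Longrightarrow> a = b"
  by (simp add: radius_def leg_def prod_eq_iff flip: Rep_spider_inject)

lemma radius_junction [simp]: "radius junction = 0"
  and leg_junction [simp]: "leg junction = None"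
  by (simp_all add: radius_def leg_def junction_def Abs_spider_inverse)

lemma radius_on_leg [simp]: "0 < y \<Longrightarrow> radius (on_leg y m) = y"
  and leg_on_leg [simp]: "0 < y \<Longrightarrow> leg (on_leg y m) = Some m"
  by (simp_all add: radius_def leg_def on_leg_def Abs_spider_inverse)

instantiation spider :: (type) metric_space
begin

definition dist_spider :: "'a spider \<Rightarrow> 'a spider \<Rightarrow> real" where
  "dist_spider a b =
     (if leg a = leg b then \<bar>radius a - radius b\<bar> else radius a + radius b)"

definition uniformity_spider :: "('a spider \<times> 'a spider) filter" where
  "uniformity_spider = (INF e\<in>{0 <..}. principal {(x, y). dist x y < e})"

definition open_spider :: "'a spider set \<Rightarrow> bool" where
  "open_spider U = (\<forall>x\<in>U. eventually (\<lambda>(x', y). x' = x \<longrightarrow> y \<in> U) uniformity)"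

instance
proof
  show "dist a b = 0 \<longleftrightarrow> a = b" for a b :: "'a spider"
    using radius_nonneg[of a] radius_nonneg[of b] radius_eq_0_iff[of a] radius_eq_0_iff[of b]
    by (auto simp: dist_spider_def add_nonneg_eq_0_iff intro: spider_eqI)
  show "dist a b \<le> dist a c + dist b c" for a b c :: "'a spider"
    using radius_nonneg[of a] radius_nonneg[of b] radius_nonneg[of c]
    by (auto simp: dist_spider_def)
qed (rule uniformity_spider_def open_spider_def)+

end

text \<open>The path space. Paths are total functions on the reals, so they are normalised to be
  \<open>undefined\<close> at negative times.\<close>

definition paths :: "(real \<Rightarrow> 'e spider) set" where
  "paths = {\<omega> \<in> extensional {0..}. continuous_on {0..} \<omega>}"

definition path_filtration :: "real \<Rightarrow> (real \<Rightarrow> 'e spider) measure" where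
  "path_filtration t =
     sigma paths {(\<lambda>\<omega>. \<omega> s) -` B \<inter> paths | s B. s \<in> {0..t} \<and> B \<in> sets borel}"

definition path_algebra :: "(real \<Rightarrow> 'e spider) measure" where
  "path_algebra = sigma paths (\<Union>s\<in>{0..}. sets (path_filtration s))"

definition path_law :: "(real \<Rightarrow> 'e spider) measure \<Rightarrow> bool" where
  "path_law Q \<longleftrightarrow> prob_space Q \<and> sets Q = sets path_algebra"

text \<open>The semigroup; \<open>normal_density 0 (sqrt t)\<close> is the centred Gaussian density of variance \<open>t\<close>.
  For a path law, the Markov property with respect to the natural filtration, together with the
  starting point, determines the law.\<close>

definition spider_semigroup ::
  "'e::finite pmf \<Rightarrow> real \<Rightarrow> ('e spider \<Rightarrow> real) \<Rightarrow> 'e spider \<Rightarrow> real" where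
  "spider_semigroup \<mu> t f a =
     (let p = normal_density 0 (sqrt t); x = radius a in
       2 * (\<Sum>m\<in>UNIV. pmf \<mu> m * (LINT y:{0<..}|lborel. p (x + y) * f (on_leg y m))) +
       (case leg a of
          None \<Rightarrow> 0
        | Some k \<Rightarrow> LINT y:{0<..}|lborel. (p (x - y) - p (x + y)) * f (on_leg y k)))"

definition brownian_spider ::
  "'e::finite pmf \<Rightarrow> 'e spider \<Rightarrow> (real \<Rightarrow> 'e spider) measure \<Rightarrow> bool" where
  "brownian_spider \<mu> a W \<longleftrightarrow>
     path_law W \<and>
     (AE \<omega> in W. \<omega> 0 = a) \<and>
     (\<forall>s\<ge>0. \<forall>t>0. \<forall>f\<in>borel_measurable borel. bounded (range f) \<longrightarrow>
        (AE \<omega> in W. real_cond_exp W (path_filtration s) (\<lambda>\<omega>. f (\<omega> (s + t))) \<omega>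
                      = spider_semigroup \<mu> t f (\<omega> s)))"

definition leg_weight :: "('e \<Rightarrow> real) \<Rightarrow> 'e spider \<Rightarrow> real" where
  "leg_weight \<alpha> a = (case leg a of None \<Rightarrow> 0 | Some m \<Rightarrow> \<alpha> m * radius a)"

definition penalized ::
  "(real \<Rightarrow> 'e spider) measure \<Rightarrow> ('e \<Rightarrow> real) \<Rightarrow> real \<Rightarrow> (real \<Rightarrow> 'e spider) measure" where
  "penalized W \<alpha> t =
     density W (\<lambda>\<omega>. ennreal (exp (leg_weight \<alpha> (\<omega> t)) /
                              (\<integral>\<omega>'. exp (leg_weight \<alpha> (\<omega>' t)) \<partial>W)))"

definition penalized_limit ::
  "(real \<Rightarrow> 'e spider) measure \<Rightarrow> ('e \<Rightarrow> real) \<Rightarrow> (real \<Rightarrow> 'e spider) measure" where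
  "penalized_limit W \<alpha> =
     (THE Q. path_law Q \<and>
        (\<forall>s\<ge>0. \<forall>\<Lambda>\<in>sets (path_filtration s).
           ((\<lambda>t. measure (penalized W \<alpha> t) \<Lambda>) \<longlongrightarrow> measure Q \<Lambda>) at_top))"

text \<open>The almost-sure sign condition is needed because \<open>ennreal\<close> truncates negative values to \<open>0\<close>.\<close>

definition has_density_on ::
  "'a measure \<Rightarrow> 'a measure \<Rightarrow> 'a measure \<Rightarrow> ('a \<Rightarrow> real) \<Rightarrow> bool" where
  "has_density_on \<nu> W F g \<longleftrightarrow>
     g \<in> borel_measurable F \<and>
     (AE \<omega> in restr_to_subalg W F. 0 \<le> g \<omega>) \<and>
     restr_to_subalg \<nu> F = density (restr_to_subalg W F) (\<lambda>\<omega>. ennreal (g \<omega>))"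

text \<open>Derivatives are taken within \<open>S\<close>, hence one-sided at the endpoint \<open>0\<close> of \<open>{0..}\<close>.\<close>

primrec C_on :: "nat \<Rightarrow> real set \<Rightarrow> (real \<Rightarrow> real) \<Rightarrow> bool" where
  "C_on 0 S f \<longleftrightarrow> continuous_on S f"
| "C_on (Suc k) S f \<longleftrightarrow>
     (\<exists>f'. (\<forall>x\<in>S. (f has_real_derivative f' x) (at x within S)) \<and> C_on k S f')"

end

theory Submission
  imports Defs
begin

text \<open>Let \<open>F\<close> denote the spatial part of the density as a function on the spider.  Since the densities
  \<open>h s * F (A\<^sub>s)\<close> form a martingale under the law \<open>W\<close> of the Brownian spider, the Markov property
  gives \<open>h (s + t) * P\<^sub>t F = h s * F\<close>.  Evaluated where \<open>F\<close> does not vanish, this makes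
  \<open>h s / h (s + t)\<close> independent of \<open>s\<close>, so \<open>h\<close> is multiplicative and hence an exponential
  \<open>exp (- \<lambda> s)\<close>, and \<open>F\<close> is a nonnegative eigenfunction: \<open>P\<^sub>t F = exp (\<lambda> t) F\<close>.  The rate satisfies
  \<open>\<lambda> \<ge> 0\<close>, because \<open>sqrt t * p\<^sub>t(y)\<close> increases with \<open>t\<close> and so \<open>P\<^sub>t F\<close> at the junction cannot decay
  exponentially; write \<open>\<lambda> = \<beta>\<^sup>2 / 2\<close>.

  Seen from one leg \<open>j\<close>, the spider unfolds to a line: \<open>P\<^sub>t F\<close> on leg \<open>j\<close> is the Gaussian
  convolution of the function \<open>v\<close> that equals \<open>F\<close> on the leg and \<open>2 * (mean of F) - F\<close>, reflected, on
  the negative half-line (\<open>nn_semigroup_unfold_at\<close>).  Thus \<open>v\<close> is an eigenfunction of all Gaussian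
  convolutions.  Instead of differentiating, the proof uses that the Gaussian averages
  \<open>\<integral> exp (- n z\<^sup>2) U(z) dz\<close>, \<open>n = 1, 2, \<dots>\<close>, determine an even continuous function \<open>U\<close>
  (Stone-Weierstrass in the variable \<open>exp (- z\<^sup>2)\<close>, lemma \<open>gaussian_moments_inj\<close>).  This turns the
  eigenvalue relation into the functional equation \<open>v (x + z) + v (x - z) = 2 * v x * cosh (\<beta> z)\<close>,
  whose solutions with \<open>v 0 = 1\<close> are \<open>cosh (\<beta> x) + c * sinh (\<beta> x)\<close> when \<open>\<beta> > 0\<close>.  If \<open>\<beta> = 0\<close> then
  \<open>F\<close> is bounded, hence constant, and \<open>\<nu> = W\<close>, which is excluded.

  The mean of \<open>F\<close> over the legs is \<open>cosh (\<beta> x)\<close> and \<open>F \<ge> 0\<close>; for a function of the form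
  \<open>cosh (\<beta> x) + c j * sinh (\<beta> x)\<close> on each leg \<open>j\<close> these two facts say exactly that it is a convex
  combination, with weights \<open>w m\<close>, of the eigenfunctions
  \<open>leg_harmonic \<mu> \<beta> m\<close>, which equal \<open>exp (- \<beta> x)\<close> off leg \<open>m\<close> and
  \<open>exp (- \<beta> x) + sinh (\<beta> x) / \<mu>\<^sub>m\<close> on it.  The penalizing weight of leg \<open>m\<close> differs from
  \<open>2 * \<mu>\<^sub>m * leg_harmonic \<mu> \<beta> m\<close> by at most one, whereas its expectation grows like
  \<open>exp (\<beta>\<^sup>2 t / 2)\<close>; so the penalized measures converge on every \<open>\<F>\<^sub>s\<close> to the one with density
  \<open>exp (- \<beta>\<^sup>2 s / 2) * leg_harmonic \<mu> \<beta> m (A\<^sub>s)\<close> (\<open>penalized_tendsto\<close>).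

  The limits on the \<open>\<F>\<^sub>s\<close> must still come from a probability measure on the whole path space.  For a
  leg of positive weight, \<open>w m\<close> times the limit is dominated by \<open>\<nu>\<close>, so continuity at the empty set is inherited from \<open>\<nu>\<close> and Caratheodory's theorem applies
  (\<open>path_law_extension\<close>).  Legs of weight zero do not enter the sum.\<close>

section \<open>Legs of the spider\<close>

text \<open>The junction is put at nonpositive arguments so that each leg is a continuous curve defined on the
  whole real line.\<close>

definition spoke :: "'e \<Rightarrow> real \<Rightarrow> 'e spider" where
  "spoke k y = (if 0 < y then on_leg y k else junction)"

lemma radius_spoke [simp]: "radius (spoke k y) = max 0 y"
  by (simp add: spoke_def)

lemma leg_spoke: "leg (spoke k y) = (if 0 < y then Some k else None)"
  by (simp add: spoke_def)

lemma spoke_nonpos [simp]: "y \<le> 0 \<Longrightarrow> spoke k y = junction"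
  by (simp add: spoke_def)

lemma spoke_leg_radius [simp]: "spoke (the (leg a)) (radius a) = a"
proof (cases "leg a")
  case None
  then show ?thesis
    using radius_eq_0_iff[of a] by (intro spider_eqI) auto
next
  case (Some k)
  then have "0 < radius a"
    using radius_eq_0_iff[of a] radius_nonneg[of a] by (auto simp: less_le)
  with Some show ?thesis
    by (intro spider_eqI) (auto simp: leg_spoke)
qed

lemma dist_spoke_le: "dist (spoke k x) (spoke k y) \<le> \<bar>x - y\<bar>"
  by (auto simp: dist_spider_def leg_spoke)

lemma continuous_on_spoke: "continuous_on A (spoke k)"
  unfolding continuous_on_iff
  by (metis dist_real_def dist_spoke_le le_less_trans)

lemma measurable_spoke [measurable]: "spoke k \<in> borel \<rightarrow>\<^sub>M borel"
  by (intro borel_measurable_continuous_onI continuous_on_spoke)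

lemma continuous_on_radius: "continuous_on A radius"
proof -
  have "\<bar>radius x - radius y\<bar> \<le> dist x y" for x y :: "'a spider"
    using radius_nonneg[of x] radius_nonneg[of y] by (auto simp: dist_spider_def)
  then show ?thesis
    unfolding continuous_on_iff dist_real_def by (meson le_less_trans)
qed

lemma measurable_radius [measurable]: "radius \<in> borel \<rightarrow>\<^sub>M borel"
  by (intro borel_measurable_continuous_onI continuous_on_radius)


lemma open_leg: "open {a :: 'e spider. leg a = Some k}"
  unfolding open_dist
proof (intro ballI)
  fix a :: "'e spider"
  assume "a \<in> {a. leg a = Some k}"
  then have a: "leg a = Some k" "0 < radius a"
    using radius_eq_0_iff[of a] radius_nonneg[of a] by (auto simp: less_le)
  have "leg b = Some k" if "dist b a < radius a" for b
    using that a radius_nonneg[of b] by (auto simp: dist_spider_def split: if_splits)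
  with a show "\<exists>e>0. \<forall>y. dist y a < e \<longrightarrow> y \<in> {a. leg a = Some k}"
    by blast
qed

lemma measurable_leg [measurable]: "leg \<in> borel \<rightarrow>\<^sub>M count_space (UNIV :: 'e::finite option set)"
proof (rule measurable_count_space_eq2[THEN iffD2], simp, safe)
  fix l :: "'e option"
  have "leg -` {l} \<inter> space borel = {a. leg a = l}" by auto
  moreover have "{a. leg a = l} \<in> sets borel"
  proof (cases l)
    case None
    then have "{a. leg a = l} = UNIV - (\<Union>k. {a. leg a = Some k})" by auto
    moreover have "(\<Union>k. {a :: 'e spider. leg a = Some k}) \<in> sets borel"
      by (intro sets.finite_UN) (auto intro: borel_open open_leg)
    ultimately show ?thesis by auto
  qed (auto intro: borel_open open_leg)
  ultimately show "leg -` {l} \<inter> space borel \<in> sets borel" by simp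
qed auto

text \<open>Every point is \<open>spoke k (radius a)\<close> for the index \<open>k\<close> of its leg, and there are finitely many
  indices, so functions on the spider can be examined leg by leg.\<close>

lemma borel_measurable_spiderI:
  fixes F :: "'e::finite spider \<Rightarrow> 'b::topological_space"
  assumes "\<And>k. (\<lambda>y. F (spoke k y)) \<in> borel_measurable borel"
  shows "F \<in> borel_measurable borel"
proof -
  note assms [measurable]
  have "(\<lambda>a. F (spoke (the (leg a)) (radius a))) \<in> borel_measurable borel"
  proof (rule measurable_compose_countable[where f = "\<lambda>k a. F (spoke k (radius a))" and g = "\<lambda>a. the (leg a)"])
    show "(\<lambda>a :: 'e spider. the (leg a)) \<in> borel \<rightarrow>\<^sub>M count_space UNIV"
      by (rule measurable_compose[OF measurable_leg]) simp
  qed measurable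
  then show ?thesis by simp
qed

section \<open>The canonical filtration of the path space\<close>

lemma space_path_filtration [simp]: "space (path_filtration t) = paths"
  by (simp add: path_filtration_def space_measure_of_conv)

lemma sets_path_filtration:
  "sets (path_filtration t) = sigma_sets paths {(\<lambda>\<omega>. \<omega> s) -` B \<inter> paths | s B. s \<in> {0..t} \<and> B \<in> sets borel}"
  unfolding path_filtration_def by (rule sets_measure_of) auto

lemma sets_path_filtration_mono: "s \<le> t \<Longrightarrow> sets (path_filtration s) \<subseteq> sets (path_filtration t)"
  unfolding sets_path_filtration by (rule sigma_sets_mono') force

text \<open>The events that depend on the path up to some finite time.  They form an algebra, not a
  \<open>\<sigma>\<close>-algebra, and generate \<open>path_algebra\<close>.\<close>

definition cylinders :: "(real \<Rightarrow> 'e spider) set set" where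
  "cylinders = (\<Union>s\<in>{0..}. sets (path_filtration s))"

lemma cylinders_subset: "cylinders \<subseteq> Pow paths"
  unfolding cylinders_def using sets.sets_into_space[of _ "path_filtration _"] by auto

lemma sets_path_algebra: "sets path_algebra = sigma_sets paths cylinders"
  unfolding path_algebra_def cylinders_def[symmetric] using cylinders_subset by (rule sets_measure_of)

lemma cylindersI: "0 \<le> s \<Longrightarrow> A \<in> sets (path_filtration s) \<Longrightarrow> A \<in> cylinders"
  by (auto simp: cylinders_def)

lemma algebra_cylinders: "algebra paths cylinders"
proof -
  have common: "\<exists>s\<ge>0. A \<in> sets (path_filtration s) \<and> B \<in> sets (path_filtration s)"
    if "A \<in> cylinders" "B \<in> cylinders" for A B :: "(real \<Rightarrow> 'a spider) set"
  proof -
    from that obtain s t where "s \<ge> 0" "t \<ge> 0" "A \<in> sets (path_filtration s)" "B \<in> sets (path_filtration t)"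
      by (auto simp: cylinders_def)
    then show ?thesis
      using sets_path_filtration_mono[of s "max s t"] sets_path_filtration_mono[of t "max s t"]
      by (intro exI[of _ "max s t"]) auto
  qed
  show ?thesis
    unfolding algebra_iff_Un
  proof (intro conjI ballI)
    show "cylinders \<subseteq> Pow (paths :: (real \<Rightarrow> 'a spider) set)" by (rule cylinders_subset)
    show "{} \<in> (cylinders :: (real \<Rightarrow> 'a spider) set set)" by (rule cylindersI[of 0]) auto
    show "paths - A \<in> cylinders" if "A \<in> cylinders" for A :: "(real \<Rightarrow> 'a spider) set"
      using common[OF that that] sets.compl_sets[of A "path_filtration _"] by (auto intro: cylindersI)
    show "A \<union> B \<in> cylinders" if "A \<in> cylinders" "B \<in> cylinders" for A B :: "(real \<Rightarrow> 'a spider) set"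
      using common[OF that] by (auto intro: cylindersI)
  qed
qed

lemma Int_stable_cylinders: "Int_stable cylinders"
  using algebra.Int_stable[OF algebra_cylinders] .

context
  fixes Q :: "(real \<Rightarrow> 'e spider) measure"
  assumes Q: "path_law Q"
begin

lemma prob_space_path_law: "prob_space Q" and sets_path_law: "sets Q = sets path_algebra"
  using Q by (auto simp: path_law_def)

lemma space_path_law [simp]: "space Q = paths"
  using sets_eq_imp_space_eq[OF sets_path_law] by (simp add: path_algebra_def space_measure_of_conv)

lemma cylinders_path_law: "A \<in> cylinders \<Longrightarrow> A \<in> sets Q"
  unfolding sets_path_law sets_path_algebra by auto

lemma subalgebra_path_filtration: "0 \<le> s \<Longrightarrow> subalgebra Q (path_filtration s)"
  using cylinders_path_law cylindersI by (auto simp: subalgebra_def)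

lemma path_filtration_sets_path_law:
  "0 \<le> s \<Longrightarrow> A \<in> sets (path_filtration s) \<Longrightarrow> A \<in> sets Q"
  by (simp add: cylindersI cylinders_path_law)

end

lemma measurable_eval_filtration: "0 \<le> s \<Longrightarrow> s \<le> t \<Longrightarrow> (\<lambda>\<omega>. \<omega> s) \<in> path_filtration t \<rightarrow>\<^sub>M borel"
  by (rule measurableI) (auto simp: sets_path_filtration intro!: sigma_sets.Basic)

lemma measurable_eval: "path_law Q \<Longrightarrow> 0 \<le> s \<Longrightarrow> (\<lambda>\<omega>. \<omega> s) \<in> Q \<rightarrow>\<^sub>M borel"
  by (rule measurable_from_subalg[OF subalgebra_path_filtration measurable_eval_filtration]) auto

lemma path_law_eqI:
  assumes "path_law Q" "path_law R"
    and "\<And>A. A \<in> cylinders \<Longrightarrow> measure Q A = measure R A"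
  shows "Q = R"
proof -
  interpret Q: prob_space Q using assms(1) by (rule prob_space_path_law)
  interpret R: prob_space R using assms(2) by (rule prob_space_path_law)
  have "paths \<in> cylinders" using algebra.top[OF algebra_cylinders] .
  then show ?thesis
    using assms Int_stable_cylinders cylinders_subset
    by (intro measure_eqI_generator_eq[where A = "\<lambda>_. paths" and \<Omega> = paths and E = cylinders])
       (auto simp: sets_path_law sets_path_algebra Q.emeasure_eq_measure R.emeasure_eq_measure)
qed

section \<open>Gaussian convolution and hyperbolic functions\<close>

text \<open>The identities obtained from densities hold for almost every \<open>x > 0\<close> only; between continuous
  functions they extend to all \<open>x \<ge> 0\<close>, because a complement that is open near a point of
  \<open>[0, \<infinity>)\<close> contains an interval.\<close>

lemma AE_lborel_closedD:
  fixes S :: "real set"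
  assumes AE: "AE x in lborel. 0 < x \<longrightarrow> x \<in> S" and "closed S" and "0 \<le> y"
  shows "y \<in> S"
proof (rule ccontr)
  assume "y \<notin> S"
  with \<open>closed S\<close> obtain e where e: "0 < e" "ball y e \<subseteq> - S"
    by (metis ComplI open_Compl open_contains_ball)
  have "AE x in lborel. x \<notin> {y<..<y + e}"
    using AE
  proof eventually_elim
    case (elim x)
    show ?case
    proof
      assume x: "x \<in> {y<..<y + e}"
      then have "x \<in> ball y e" by (simp add: dist_real_def)
      with e x elim \<open>0 \<le> y\<close> show False by auto
    qed
  qed
  then have "emeasure lborel {y<..<y + e} = 0"
    by (subst (asm) AE_iff_null_sets[symmetric]) (auto simp: null_sets_def)
  with e show False by simp
qed

text \<open>Completing the square turns the integrand into a multiple of the Gaussian density centred at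
  \<open>x + b * t\<close>.\<close>

lemma has_bochner_integral_gaussian_exp:
  assumes "0 < t"
  shows "has_bochner_integral lborel (\<lambda>y. normal_density 0 (sqrt t) (x - y) * exp (b * y))
           (exp (b\<^sup>2 * t / 2) * exp (b * x))"
proof -
  have "normal_density 0 (sqrt t) (x - y) * exp (b * y)
      = exp (b\<^sup>2 * t / 2) * exp (b * x) * normal_density (x + b * t) (sqrt t) y" for y
  proof -
    have "- (x - y)\<^sup>2 / (2 * t) + b * y
        = b\<^sup>2 * t / 2 + b * x + (- (y - (x + b * t))\<^sup>2 / (2 * t))"
      using assms by (simp add: field_simps power2_eq_square)
    then show ?thesis
      using assms by (simp add: normal_density_def field_simps flip: exp_add)
  qed
  then show ?thesis
    using assms has_bochner_integral_mult_right[of "exp (b\<^sup>2 * t / 2) * exp (b * x)" lborel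
      "normal_density (x + b * t) (sqrt t)" 1]
    by (simp add: has_bochner_integral_iff)
qed

lemma has_bochner_integral_gaussian_hyperbolic:
  assumes "0 < t"
  shows "has_bochner_integral lborel (\<lambda>y. normal_density 0 (sqrt t) (x - y) * (cosh (b * y) + c * sinh (b * y)))
           (exp (b\<^sup>2 * t / 2) * (cosh (b * x) + c * sinh (b * x)))"
proof -
  have "has_bochner_integral lborel
      (\<lambda>y. (1 + c) / 2 * (normal_density 0 (sqrt t) (x - y) * exp (b * y))
         + (1 - c) / 2 * (normal_density 0 (sqrt t) (x - y) * exp (- b * y)))
      ((1 + c) / 2 * (exp (b\<^sup>2 * t / 2) * exp (b * x)) + (1 - c) / 2 * (exp ((- b)\<^sup>2 * t / 2) * exp (- b * x)))"
    by (intro has_bochner_integral_add has_bochner_integral_mult_right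
        has_bochner_integral_gaussian_exp assms)
  also have "(\<lambda>y. (1 + c) / 2 * (normal_density 0 (sqrt t) (x - y) * exp (b * y))
         + (1 - c) / 2 * (normal_density 0 (sqrt t) (x - y) * exp (- b * y)))
      = (\<lambda>y. normal_density 0 (sqrt t) (x - y) * (cosh (b * y) + c * sinh (b * y)))"
    by (simp add: fun_eq_iff cosh_def sinh_def field_simps)
  also have "(1 + c) / 2 * (exp (b\<^sup>2 * t / 2) * exp (b * x)) + (1 - c) / 2 * (exp ((- b)\<^sup>2 * t / 2) * exp (- b * x))
      = exp (b\<^sup>2 * t / 2) * (cosh (b * x) + c * sinh (b * x))"
    by (simp add: cosh_def sinh_def field_simps)
  finally show ?thesis .
qed

lemma has_bochner_integral_fold:
  fixes r :: "real \<Rightarrow> real"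
  assumes "has_bochner_integral lborel r I"
  shows "has_bochner_integral lborel (\<lambda>y. indicator {0<..} y * (r y + r (- y))) I"
proof -
  have int: "integrable lborel r" and I: "I = (\<integral>y. r y \<partial>lborel)"
    using assms by (auto simp: has_bochner_integral_iff)
  have pos: "integrable lborel (\<lambda>y. indicator {0<..} y * r y)"
    and neg: "integrable lborel (\<lambda>y. indicator {..<0} y * r y)"
    using integrable_mult_indicator[OF _ int, of "{0<..}"] integrable_mult_indicator[OF _ int, of "{..<0}"]
    by auto
  have neg': "has_bochner_integral lborel (\<lambda>y. indicator {0<..} y * r (- y))
      (\<integral>y. indicator {..<0} y * r y \<partial>lborel)"
    using lborel_has_bochner_integral_real_affine_iff[of "-1" "\<lambda>y. indicator {..<0} y * r y"
        "\<integral>y. indicator {..<0} y * r y \<partial>lborel" 0] neg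
    by (simp add: has_bochner_integral_iff indicator_def)
  have "has_bochner_integral lborel (\<lambda>y. indicator {0<..} y * r y + indicator {0<..} y * r (- y))
      ((\<integral>y. indicator {0<..} y * r y \<partial>lborel) + (\<integral>y. indicator {..<0} y * r y \<partial>lborel))"
    using neg' by (intro has_bochner_integral_add) (auto simp: has_bochner_integral_iff pos)
  also have "(\<integral>y. indicator {0<..} y * r y \<partial>lborel) + (\<integral>y. indicator {..<0} y * r y \<partial>lborel)
      = (\<integral>y. indicator {0<..} y * r y + indicator {..<0} y * r y \<partial>lborel)"
    using pos neg by simp
  also have "\<dots> = I"
    unfolding I
  proof (rule integral_cong_AE)
    show "AE y in lborel. indicator {0<..} y * r y + indicator {..<0} y * r y = r y"
      using AE_lborel_singleton[of 0] by eventually_elim (auto simp: indicator_def)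
  qed (use int pos neg in auto)
  finally show ?thesis by (simp add: distrib_left)
qed

lemma has_bochner_integral_even:
  fixes r :: "real \<Rightarrow> real"
  assumes half: "has_bochner_integral lborel (\<lambda>y. indicator {0<..} y * (2 * r y)) I"
    and even: "\<And>y. r (- y) = r y" and [measurable]: "r \<in> borel_measurable borel"
  shows "has_bochner_integral lborel r I"
proof -
  have pos: "has_bochner_integral lborel (\<lambda>y. indicator {0<..} y * r y) (I / 2)"
    using has_bochner_integral_divide_zero[OF half, of 2] by (simp add: field_simps)
  have neg: "has_bochner_integral lborel (\<lambda>y. indicator {..<0} y * r y) (I / 2)"
    using lborel_has_bochner_integral_real_affine_iff[of "-1" "\<lambda>y. indicator {0<..} y * r y" "I / 2" 0] pos
    by (simp add: even indicator_def)
  have "has_bochner_integral lborel (\<lambda>y. indicator {0<..} y * r y + indicator {..<0} y * r y) (I / 2 + I / 2)"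
    by (intro has_bochner_integral_add pos neg)
  moreover have "AE y in lborel. indicator {0<..} y * r y + indicator {..<0} y * r y = r y"
    using AE_lborel_singleton[of 0] by eventually_elim (auto simp: indicator_def)
  ultimately show ?thesis
    by (subst has_bochner_integral_cong_AE[where g = "\<lambda>y. indicator {0<..} y * r y + indicator {..<0} y * r y"])
       (auto elim: eventually_mono)
qed

text \<open>In the variable \<open>q = exp (- z\<^sup>2)\<close> the hypotheses say that all moments of \<open>U(z) exp (- z\<^sup>2) dz\<close>
  vanish.  By the Weierstrass theorem this measure then annihilates every continuous function of
  \<open>q\<close>, in particular \<open>U\<close> itself cut off away from \<open>q = 0\<close>, so a weighted integral of \<open>U\<^sup>2\<close> is zero.\<close>

lemma gaussian_moments_inj:
  fixes U :: "real \<Rightarrow> real"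
  assumes cont: "continuous_on UNIV U" and even: "\<And>z. U (- z) = U z"
    and mom: "\<And>n :: nat. 1 \<le> n \<Longrightarrow> has_bochner_integral lborel (\<lambda>z. exp (- (real n * z\<^sup>2)) * U z) 0"
  shows "U z = 0"
proof -
  define m where "m z = exp (- z\<^sup>2) * U z" for z
  have m: "integrable lborel m"
    using mom[of 1] by (simp add: m_def[abs_def] has_bochner_integral_iff)
  note [measurable] = borel_measurable_continuous_onI[OF cont]
  have poly: "has_bochner_integral lborel (\<lambda>z. P (exp (- z\<^sup>2)) * m z) 0"
    if "real_polynomial_function P" for P
  proof -
    from that obtain a n where P: "P = (\<lambda>q. \<Sum>i\<le>n. a i * q ^ i)"
      unfolding real_polynomial_function_iff_sum by blast
    have "has_bochner_integral lborel (\<lambda>z. \<Sum>i\<le>n. a i * (exp (- (real (Suc i) * z\<^sup>2)) * U z)) (\<Sum>i\<le>n. a i * 0)"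
      by (intro has_bochner_integral_sum has_bochner_integral_mult_right mom) auto
    also have "(\<lambda>z. \<Sum>i\<le>n. a i * (exp (- (real (Suc i) * z\<^sup>2)) * U z)) = (\<lambda>z. P (exp (- z\<^sup>2)) * m z)"
      unfolding P m_def fun_eq_iff sum_distrib_right
      by (intro allI sum.cong refl)
         (simp add: algebra_simps flip: exp_of_nat_mult exp_add)
    finally show ?thesis by simp
  qed
  have test: "(\<integral>z. \<phi> (exp (- z\<^sup>2)) * m z \<partial>lborel) = 0" if \<phi>: "continuous_on {0..1} \<phi>"
    and int: "integrable lborel (\<lambda>z. \<phi> (exp (- z\<^sup>2)) * m z)" for \<phi> :: "real \<Rightarrow> real"
  proof -
    have "\<bar>\<integral>z. \<phi> (exp (- z\<^sup>2)) * m z \<partial>lborel\<bar> \<le> e * (\<integral>z. \<bar>m z\<bar> \<partial>lborel)" if "0 < e" for e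
    proof -
      obtain P where P: "real_polynomial_function P" "\<And>q. q \<in> {0..1} \<Longrightarrow> \<bar>\<phi> q - P q\<bar> < e"
        by (rule Stone_Weierstrass_real_polynomial_function[OF compact_Icc \<phi> \<open>0 < e\<close>]) blast
      have "(\<integral>z. \<phi> (exp (- z\<^sup>2)) * m z \<partial>lborel)
          = (\<integral>z. \<phi> (exp (- z\<^sup>2)) * m z - P (exp (- z\<^sup>2)) * m z \<partial>lborel)"
        using poly[OF P(1)] int by (simp add: has_bochner_integral_iff)
      also have "\<bar>\<dots>\<bar> \<le> (\<integral>z. e * \<bar>m z\<bar> \<partial>lborel)"
      proof (rule integral_abs_bound[THEN order_trans], rule integral_mono)
        show "\<bar>\<phi> (exp (- z\<^sup>2)) * m z - P (exp (- z\<^sup>2)) * m z\<bar> \<le> e * \<bar>m z\<bar>" for z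
          using P(2)[of "exp (- z\<^sup>2)"]
          unfolding left_diff_distrib[symmetric] abs_mult by (intro mult_right_mono) auto
      qed (use poly[OF P(1)] int m in \<open>auto simp: has_bochner_integral_iff\<close>)
      finally show ?thesis by simp
    qed
    then have ev: "\<forall>\<^sub>F e in at_right 0. \<bar>\<integral>z. \<phi> (exp (- z\<^sup>2)) * m z \<partial>lborel\<bar> \<le> e * (\<integral>z. \<bar>m z\<bar> \<partial>lborel)"
      by (intro eventually_mono[OF eventually_at_right_less])
    have "((\<lambda>e. e * (\<integral>z. \<bar>m z\<bar> \<partial>lborel)) \<longlongrightarrow> 0 * (\<integral>z. \<bar>m z\<bar> \<partial>lborel)) (at_right 0)"
      by (intro tendsto_intros)
    then have "\<bar>\<integral>z. \<phi> (exp (- z\<^sup>2)) * m z \<partial>lborel\<bar> \<le> 0 * (\<integral>z. \<bar>m z\<bar> \<partial>lborel)"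
      using ev by (rule tendsto_lowerbound) simp
    then show ?thesis by simp
  qed
  define \<delta> where "\<delta> = exp (- z\<^sup>2) / 2"
  have \<delta>: "0 < \<delta>" "\<delta> < 1"
    using exp_le_one_iff[of "- z\<^sup>2"] by (simp_all add: \<delta>_def del: exp_le_one_iff)
  \<comment> \<open>The test function is \<open>U\<close> as a function of \<open>q = exp (- z\<^sup>2)\<close>; the factor \<open>max 0 (q - \<delta>)\<close> and
    the argument \<open>max q \<delta>\<close> keep it continuous down to \<open>q = 0\<close>, and \<open>\<delta>\<close> is chosen below
    \<open>exp (- z\<^sup>2)\<close> for the given point \<open>z\<close>.\<close>
  define \<phi> where "\<phi> q = max 0 (q - \<delta>) * U (sqrt (- ln (max q \<delta>)))" for q
  have \<phi>: "continuous_on {0..1} \<phi>"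
    unfolding \<phi>_def using \<delta>
    by (intro continuous_intros continuous_on_compose2[OF cont]) auto
  have \<phi>_eq: "\<phi> (exp (- y\<^sup>2)) = max 0 (exp (- y\<^sup>2) - \<delta>) * U y" for y
  proof (cases "exp (- y\<^sup>2) \<le> \<delta>")
    case False
    then have "\<phi> (exp (- y\<^sup>2)) = max 0 (exp (- y\<^sup>2) - \<delta>) * U \<bar>y\<bar>"
      by (simp add: \<phi>_def max_def)
    then show ?thesis using even[of y] by (simp add: abs_if split: if_splits)
  qed (simp add: \<phi>_def)
  let ?r = "\<lambda>y. max 0 (exp (- y\<^sup>2) - \<delta>) * exp (- y\<^sup>2) * (U y)\<^sup>2"
  have r: "\<phi> (exp (- y\<^sup>2)) * m y = ?r y" for y
    unfolding \<phi>_eq m_def by (simp add: power2_eq_square)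
  obtain B where B: "\<forall>q\<in>{0..1}. \<bar>\<phi> q\<bar> \<le> B"
    using compact_imp_bounded[OF compact_continuous_image[OF \<phi> compact_Icc]]
    by (auto simp: bounded_iff)
  have int: "integrable lborel ?r"
  proof (rule Bochner_Integration.integrable_bound)
    show "integrable lborel (\<lambda>z. B * m z)" using m by simp
    show "AE y in lborel. norm (?r y) \<le> norm (B * m y)"
    proof (rule AE_I2)
      fix y
      have "\<bar>\<phi> (exp (- y\<^sup>2)) * m y\<bar> \<le> \<bar>B * m y\<bar>"
        unfolding abs_mult by (intro mult_right_mono order_trans[OF B[rule_format]]) auto
      then show "norm (?r y) \<le> norm (B * m y)"
        unfolding r by simp
    qed
  qed measurable
  have "(\<integral>y. ?r y \<partial>lborel) = 0"
    using test[OF \<phi>] int unfolding r by simp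
  then have "AE y in lborel. ?r y = 0"
    using int by (subst (asm) integral_nonneg_eq_0_iff_AE) auto
  then have "AE y in lborel. 0 < y \<longrightarrow> y \<in> {y. ?r y = 0}"
    by eventually_elim simp
  then have "\<bar>z\<bar> \<in> {y. ?r y = 0}"
  proof (rule AE_lborel_closedD)
    show "closed {y. ?r y = 0}"
      by (intro closed_Collect_eq continuous_intros cont)
  qed simp
  moreover have "0 < max 0 (exp (- z\<^sup>2) - \<delta>)"
    by (simp add: \<delta>_def)
  ultimately have "U \<bar>z\<bar> = 0" by (auto simp: max_def split: if_splits)
  then show ?thesis using even[of z] by (simp add: abs_if split: if_splits)
qed

text \<open>The symmetrized function \<open>z \<mapsto> v (x + z) + v (x - z)\<close> and the function \<open>2 * v x * cosh (b * z)\<close>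
  have the same Gaussian averages.  The variances \<open>1 / (2 * n)\<close> are those for which the Gaussian
  density is proportional to \<open>exp (- n * z\<^sup>2)\<close>.\<close>

lemma gaussian_eigenfunction_dAlembert:
  fixes v :: "real \<Rightarrow> real"
  assumes cont: "continuous_on UNIV v"
    and eigen: "\<And>n :: nat. 1 \<le> n \<Longrightarrow>
      has_bochner_integral lborel (\<lambda>y. normal_density 0 (sqrt (1 / (2 * real n))) (x - y) * v y)
        (exp (b\<^sup>2 * (1 / (2 * real n)) / 2) * v x)"
  shows "v (x + z) + v (x - z) = 2 * v x * cosh (b * z)"
proof -
  define U where "U z = v (x + z) + v (x - z) - 2 * v x * cosh (b * z)" for z
  have "U z = 0"
  proof (rule gaussian_moments_inj[where U = U])
    show "continuous_on UNIV U"
      unfolding U_def by (intro continuous_intros continuous_on_compose2[OF cont]) auto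
    show "U (- z) = U z" for z by (simp add: U_def)
    fix n :: nat assume n: "1 \<le> n"
    let ?t = "1 / (2 * real n)"
    let ?p = "normal_density 0 (sqrt ?t)"
    have p: "?p z = sqrt (real n / pi) * exp (- (real n * z\<^sup>2))" for z
      using n by (simp add: normal_density_def real_sqrt_divide field_simps)
    have p_minus: "?p (- z) = ?p z" for z by (simp add: normal_density_def)
    have plus: "has_bochner_integral lborel (\<lambda>z. ?p z * v (x + z)) (exp (b\<^sup>2 * ?t / 2) * v x)"
      using lborel_has_bochner_integral_real_affine_iff[of 1 "\<lambda>y. ?p (x - y) * v y" _ x] eigen[OF n]
      by (simp add: p_minus)
    have minus: "has_bochner_integral lborel (\<lambda>z. ?p z * v (x - z)) (exp (b\<^sup>2 * ?t / 2) * v x)"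
      using lborel_has_bochner_integral_real_affine_iff[of "-1" "\<lambda>y. ?p (x - y) * v y" _ x] eigen[OF n]
      by simp
    have cosh: "has_bochner_integral lborel (\<lambda>z. ?p z * cosh (b * z)) (exp (b\<^sup>2 * ?t / 2))"
      using has_bochner_integral_gaussian_hyperbolic[of ?t 0 b 0] n by (simp add: p_minus)
    have "has_bochner_integral lborel
        (\<lambda>z. ?p z * v (x + z) + ?p z * v (x - z) - 2 * v x * (?p z * cosh (b * z)))
        (exp (b\<^sup>2 * ?t / 2) * v x + exp (b\<^sup>2 * ?t / 2) * v x - 2 * v x * exp (b\<^sup>2 * ?t / 2))"
      by (intro has_bochner_integral_add has_bochner_integral_diff has_bochner_integral_mult_right plus minus cosh)
    also have "(\<lambda>z. ?p z * v (x + z) + ?p z * v (x - z) - 2 * v x * (?p z * cosh (b * z))) = (\<lambda>z. ?p z * U z)"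
      by (simp add: U_def fun_eq_iff algebra_simps)
    finally have "has_bochner_integral lborel (\<lambda>z. inverse (sqrt (real n / pi)) * (?p z * U z)) (inverse (sqrt (real n / pi)) * 0)"
      by (intro has_bochner_integral_mult_right) simp
    also have "(\<lambda>z. inverse (sqrt (real n / pi)) * (?p z * U z)) = (\<lambda>z. exp (- (real n * z\<^sup>2)) * U z)"
      using n by (simp add: p fun_eq_iff)
    finally show "has_bochner_integral lborel (\<lambda>z. exp (- (real n * z\<^sup>2)) * U z) 0" by simp
  qed
  then show ?thesis by (simp add: U_def)
qed

context
  fixes v :: "real \<Rightarrow> real" and b :: real
  assumes eq: "\<And>x z. 0 \<le> x \<Longrightarrow> v (x + z) + v (x - z) = 2 * v x * cosh (b * z)"
    and v0: "v 0 = 1"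
begin

text \<open>Since \<open>v 0 = 1\<close>, the equation at \<open>x = 0\<close> makes \<open>d\<close> odd.  Adding the equation for \<open>(x, z)\<close> to the one for
  \<open>(z, x)\<close> then cancels \<open>d (x - z)\<close> against \<open>d (z - x)\<close> and leaves the addition theorem of
  \<open>sinh\<close>.\<close>

lemma dAlembert_addition:
  fixes d :: "real \<Rightarrow> real"
  defines "d \<equiv> \<lambda>x. v x - cosh (b * x)"
  assumes "0 \<le> x" "0 \<le> z"
  shows "d (x + z) = d x * cosh (b * z) + d z * cosh (b * x)"
proof -
  have d: "d (x + z) + d (x - z) = 2 * d x * cosh (b * z)" if "0 \<le> x" for x z
  proof -
    have "cosh (b * (x + z)) + cosh (b * (x - z)) = 2 * cosh (b * x) * cosh (b * z)"
      by (simp add: distrib_left right_diff_distrib cosh_add cosh_diff)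
    then show ?thesis using eq[OF that, of z] by (simp add: d_def algebra_simps)
  qed
  have "d (- y) = - d y" for y using d[of 0 y] by (simp add: d_def v0)
  from this[of "x - z"] d[OF assms(2), of z] d[OF assms(3), of x] show ?thesis
    by (simp add: add.commute)
qed

text \<open>Expanding \<open>d (x + 1 + z)\<close> by the addition theorem in both possible ways shows that \<open>d\<close> is
  proportional to \<open>sinh (b * x)\<close>.\<close>

lemma dAlembert_solution:
  assumes "0 < b"
  obtains c where "\<And>x. v x = cosh (b * x) + c * sinh (b * x)"
proof -
  define d where "d x = v x - cosh (b * x)" for x
  note add = dAlembert_addition[folded d_def]
  have ratio: "d x * sinh (b * z) = d z * sinh (b * x)" if "0 \<le> x" "0 \<le> z" for x z
  proof -
    have "d (x + 1 + z) = d (x + (1 + z))" by (simp add: add.assoc)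
    then have "(d x * cosh b + d 1 * cosh (b * x)) * cosh (b * z) + d z * cosh (b * (x + 1))
      = d x * cosh (b * (1 + z)) + (d 1 * cosh (b * z) + d z * cosh b) * cosh (b * x)"
      using add[of "x + 1" z] add[of x "1 + z"] add[of x 1] add[of 1 z] that by simp
    then have "d x * (cosh b * cosh (b * z) - cosh (b * (1 + z))) = d z * (cosh b * cosh (b * x) - cosh (b * (x + 1)))"
      by (simp add: algebra_simps)
    moreover have "cosh b * cosh (b * y) - cosh (b * (1 + y)) = - sinh b * sinh (b * y)" for y
      by (simp add: distrib_left cosh_add)
    ultimately have "d x * (- sinh b * sinh (b * z)) = d z * (- sinh b * sinh (b * x))"
      by (metis add.commute)
    then have "sinh b * (d x * sinh (b * z) - d z * sinh (b * x)) = 0"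
      by algebra
    moreover have "sinh b \<noteq> 0" using \<open>0 < b\<close> by simp
    ultimately show ?thesis by simp
  qed
  define c where "c = d 1 / sinh b"
  have pos: "d x = c * sinh (b * x)" if "0 \<le> x" for x
    using ratio[of x 1] that \<open>0 < b\<close> by (simp add: c_def field_simps)
  have "v x = cosh (b * x) + c * sinh (b * x)" for x
  proof (cases "0 \<le> x")
    case True
    then show ?thesis using pos[of x] by (simp add: d_def)
  next
    case False
    then show ?thesis using pos[of "- x"] eq[of 0 x] by (simp add: d_def v0)
  qed
  then show thesis by (rule that)
qed

text \<open>For \<open>b = 0\<close> the function \<open>v - 1\<close> is additive, and a bounded additive function is zero.\<close>

lemma dAlembert_bounded_const:
  assumes "b = 0" and bound: "\<And>x. 0 \<le> x \<Longrightarrow> \<bar>v x\<bar> \<le> B" and "0 \<le> x"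
  shows "v x = 1"
proof -
  define d where "d x = v x - cosh (b * x)" for x
  have add: "d (x + z) = d x + d z" if "0 \<le> x" "0 \<le> z" for x z
    using dAlembert_addition[OF that, folded d_def] \<open>b = 0\<close> by simp
  have mult: "d (real n * x) = real n * d x" for n
  proof (induction n)
    case 0
    show ?case by (simp add: d_def v0)
  next
    case (Suc n)
    then show ?case using add[of x "real n * x"] \<open>0 \<le> x\<close> by (simp add: algebra_simps)
  qed
  have "real n * \<bar>d x\<bar> \<le> B + 1" for n
  proof -
    have "\<bar>d (real n * x)\<bar> \<le> B + 1"
      using bound[of "real n * x"] \<open>0 \<le> x\<close> \<open>b = 0\<close> by (simp add: d_def)
    then show ?thesis by (simp add: mult abs_mult)
  qed
  then have "d x = 0"
    by (metis abs_le_zero_iff abs_ge_zero ex_less_of_nat_mult less_le_not_le linorder_not_le)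
  then show ?thesis using \<open>b = 0\<close> by (simp add: d_def)
qed

end

text \<open>Differentiating \<open>h (t + u) = h t * h u\<close> in \<open>u\<close> at \<open>0\<close> gives \<open>h' t = h t * h' 0\<close>.  All derivatives
  are one-sided at the left end of the half-line.\<close>

lemma multiplicative_imp_exp:
  fixes h :: "real \<Rightarrow> real"
  assumes mult: "\<And>s t. 0 \<le> s \<Longrightarrow> 0 \<le> t \<Longrightarrow> h (s + t) = h s * h t" and "h 0 = 1"
    and diff: "\<And>s. 0 \<le> s \<Longrightarrow> (h has_real_derivative h' s) (at s within {0..})" and "0 \<le> s"
  shows "h s = exp (h' 0 * s)"
proof -
  have h': "h' t = h t * h' 0" if "0 \<le> t" for t
  proof -
    have "(h has_real_derivative h' 0) (at (t - t) within {0..})" using diff[of 0] by simp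
    moreover have "(\<lambda>u. u - t) ` {t..} = {0..}"
      by (auto simp: image_def intro!: bexI[of _ "_ + t"])
    ultimately have "((\<lambda>u. h (u - t)) has_real_derivative h' 0 * 1) (at t within {t..})"
      by (intro DERIV_image_chain[unfolded o_def, where f = h and g = "\<lambda>u. u - t"])
         (auto intro!: derivative_eq_intros)
    then have "((\<lambda>u. h t * h (u - t)) has_real_derivative h t * h' 0) (at t within {t..})"
      using DERIV_cmult by fastforce
    then have "(h has_real_derivative h t * h' 0) (at t within {t..})"
      by (rule has_field_derivative_transform_within[where d = 1])
         (use that mult[OF that] in \<open>auto simp flip: mult\<close>)
    moreover have "(h has_real_derivative h' t) (at t within {t..})"
      by (rule DERIV_subset[OF diff]) (use that in auto)
    moreover have "at t within {t..} \<noteq> bot" unfolding at_within_Ici_at_right by (rule trivial_limit_at_right_real)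
    ultimately show ?thesis by (rule has_field_derivative_unique[symmetric])
  qed
  have "\<exists>c. \<forall>x\<in>{0..}. h x * exp (- (h' 0 * x)) = c"
  proof (rule has_field_derivative_zero_constant)
    show "((\<lambda>x. h x * exp (- (h' 0 * x))) has_real_derivative 0) (at x within {0..})"
      if "x \<in> {0..}" for x
    proof -
      have "(h has_real_derivative h x * h' 0) (at x within {0..})"
        using diff[of x] h'[of x] that by simp
      then show ?thesis by (auto intro!: derivative_eq_intros)
    qed
  qed simp
  then have "h s * exp (- (h' 0 * s)) = 1" using \<open>h 0 = 1\<close> \<open>0 \<le> s\<close> by force
  then show ?thesis by (simp add: exp_minus field_simps)
qed

section \<open>The semigroup and the Markov property\<close>

text \<open>The transition density from \<open>a\<close> to the point at distance \<open>y\<close> on leg \<open>k\<close>.  At the junction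
  \<open>the (leg a)\<close> is an unspecified index, which is harmless because \<open>p (x - y) - p (x + y)\<close> vanishes
  for \<open>x = 0\<close>.\<close>

definition spider_kernel :: "'e::finite pmf \<Rightarrow> real \<Rightarrow> 'e spider \<Rightarrow> 'e \<Rightarrow> real \<Rightarrow> real" where
  "spider_kernel \<mu> t a k y =
     (let p = normal_density 0 (sqrt t); x = radius a in
       2 * pmf \<mu> k * p (x + y) + (if the (leg a) = k then p (x - y) - p (x + y) else 0))"

text \<open>The semigroup for functions with values in \<open>[0, \<infinity>]\<close>.  The density under investigation is unbounded
  and its integrability is known only afterwards, so the Markov property is needed in this form.\<close>

definition nn_semigroup :: "'e::finite pmf \<Rightarrow> real \<Rightarrow> ('e spider \<Rightarrow> ennreal) \<Rightarrow> 'e spider \<Rightarrow> ennreal" where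
  "nn_semigroup \<mu> t F a =
     (\<integral>\<^sup>+ y. (\<Sum>k\<in>UNIV. ennreal (indicator {0<..} y * spider_kernel \<mu> t a k y) * F (spoke k y)) \<partial>lborel)"

text \<open>This makes the density of Brownian motion killed at the origin, and with it the kernel of the
  spider, nonnegative.\<close>

lemma normal_density_reflect_le:
  assumes "0 \<le> x" "0 \<le> y"
  shows "normal_density 0 \<sigma> (x + y) \<le> normal_density 0 \<sigma> (x - y)"
proof -
  have "(x - y)\<^sup>2 \<le> (x + y)\<^sup>2"
    using assms by (simp add: power2_eq_square algebra_simps)
  then show ?thesis
    unfolding normal_density_def by (intro mult_left_mono) (auto intro!: divide_right_mono)
qed

lemma spider_kernel_nonneg: "0 \<le> y \<Longrightarrow> 0 \<le> spider_kernel \<mu> t a k y"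
  using normal_density_reflect_le[OF radius_nonneg[of a], of y]
  by (auto simp: spider_kernel_def Let_def intro!: add_nonneg_nonneg)

lemma indicator_spider_kernel_nonneg: "0 \<le> indicator {0<..} y * spider_kernel \<mu> t a k y"
  using spider_kernel_nonneg[of y \<mu> t a k] by (auto simp: indicator_def)

lemma measurable_the_leg [measurable]:
  "(\<lambda>a :: 'e::finite spider. the (leg a)) \<in> borel \<rightarrow>\<^sub>M count_space UNIV"
  by (rule measurable_compose[OF measurable_leg]) simp

lemma borel_measurable_spider_kernel [measurable (raw)]:
  assumes [measurable]: "f \<in> M \<rightarrow>\<^sub>M borel" "g \<in> M \<rightarrow>\<^sub>M borel"
  shows "(\<lambda>x. spider_kernel \<mu> t (f x) k (g x)) \<in> borel_measurable M"
  unfolding spider_kernel_def Let_def by measurable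

lemma borel_measurable_nn_semigroup [measurable]:
  assumes [measurable]: "F \<in> borel_measurable borel"
  shows "nn_semigroup \<mu> t F \<in> borel_measurable borel"
  unfolding nn_semigroup_def[abs_def] by measurable

lemma integrable_gaussian_bounded:
  fixes f :: "real \<Rightarrow> real"
  assumes [measurable]: "f \<in> borel_measurable borel" and f: "\<And>y. \<bar>f y\<bar> \<le> B"
    and "0 < t" "c = 1 \<or> c = - 1"
  shows "integrable lborel (\<lambda>y. indicator {0<..} y * (normal_density 0 (sqrt t) (x + c * y) * f y))"
proof (rule Bochner_Integration.integrable_bound)
  have "integrable lborel (\<lambda>y. normal_density 0 (sqrt t) (x + c * y))"
    using assms by (intro lborel_integrable_real_affine) auto
  then show "integrable lborel (\<lambda>y. B * normal_density 0 (sqrt t) (x + c * y))"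
    by simp
  have "0 \<le> B" using f[of 0] by linarith
  then show "AE y in lborel. norm (indicator {0<..} y * (normal_density 0 (sqrt t) (x + c * y) * f y))
      \<le> norm (B * normal_density 0 (sqrt t) (x + c * y))"
    using mult_left_mono[OF f normal_density_nonneg]
    by (intro AE_I2) (auto simp: abs_mult indicator_def mult.commute)
qed measurable

lemma spider_semigroup_eq_nn_semigroup:
  assumes [measurable]: "f \<in> borel_measurable borel" and f: "\<And>a. 0 \<le> f a" "\<And>a. f a \<le> B" and "0 < t"
  shows "0 \<le> spider_semigroup \<mu> t f a"
    and "ennreal (spider_semigroup \<mu> t f a) = nn_semigroup \<mu> t (\<lambda>a. ennreal (f a)) a"
proof -
  define p where "p = normal_density 0 (sqrt t)"
  define x where "x = radius a"
  define j where "j = the (leg a)"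
  have f_abs: "\<bar>f a\<bar> \<le> B" for a using f[of a] by simp
  define q where "q k y = indicator {0<..} y * (p (x + y) * f (spoke k y))" for k y
  define r where "r y = indicator {0<..} y * (p (x - y) * f (spoke j y))" for y
  have q: "integrable lborel (q k)" for k
    unfolding q_def[abs_def] p_def
    using integrable_gaussian_bounded[of "\<lambda>y. f (spoke k y)" B t 1 x] f_abs \<open>0 < t\<close> by simp
  have r: "integrable lborel r"
    unfolding r_def[abs_def] p_def
    using integrable_gaussian_bounded[of "\<lambda>y. f (spoke j y)" B t "-1" x] f_abs \<open>0 < t\<close> by simp
  define K where "K k y = indicator {0<..} y * spider_kernel \<mu> t a k y * f (spoke k y)" for k y
  have K: "K k y = 2 * pmf \<mu> k * q k y + (if j = k then r y - q k y else 0)" for k y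
    by (simp add: K_def spider_kernel_def q_def r_def p_def x_def j_def Let_def algebra_simps)
  have int_K: "integrable lborel (K k)" for k
    using q[of k] r by (cases "j = k") (simp_all add: K[abs_def])
  have K_nonneg: "0 \<le> K k y" for k y
    unfolding K_def using indicator_spider_kernel_nonneg f(1) by (rule mult_nonneg_nonneg)
  have "spider_semigroup \<mu> t f a = 2 * (\<Sum>k\<in>UNIV. pmf \<mu> k * (\<integral>y. q k y \<partial>lborel)) + (\<integral>y. r y - q j y \<partial>lborel)"
  proof -
    have "(LINT y:{0<..}|lborel. p (x + y) * f (on_leg y m)) = (\<integral>y. q m y \<partial>lborel)" for m
      unfolding set_lebesgue_integral_def q_def
      by (intro Bochner_Integration.integral_cong) (auto simp: spoke_def indicator_def)
    moreover have "(case leg a of None \<Rightarrow> 0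
        | Some k \<Rightarrow> LINT y:{0<..}|lborel. (p (x - y) - p (x + y)) * f (on_leg y k)) = (\<integral>y. r y - q j y \<partial>lborel)"
    proof (cases "leg a")
      case None
      then have "x = 0" using radius_eq_0_iff[of a] by (simp add: x_def)
      then have "r y - q j y = 0" for y
        by (simp add: r_def q_def p_def normal_density_def)
      then show ?thesis using None by simp
    next
      case (Some k)
      then show ?thesis
        unfolding set_lebesgue_integral_def
        by (auto simp: spoke_def indicator_def q_def r_def j_def algebra_simps intro!: Bochner_Integration.integral_cong)
    qed
    ultimately show ?thesis
      unfolding spider_semigroup_def Let_def p_def[symmetric] x_def[symmetric] by simp
  qed
  also have "\<dots> = (\<Sum>k\<in>UNIV. (\<integral>y. K k y \<partial>lborel))"
  proof -
    have "(\<integral>y. K k y \<partial>lborel) = 2 * (pmf \<mu> k * (\<integral>y. q k y \<partial>lborel)) + (if j = k then \<integral>y. r y - q j y \<partial>lborel else 0)" for k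
      using q r by (simp add: K[abs_def] algebra_simps)
    then show ?thesis by (simp add: sum.distrib sum_distrib_left)
  qed
  also have "\<dots> = (\<integral>y. (\<Sum>k\<in>UNIV. K k y) \<partial>lborel)"
    using int_K by simp
  finally have eq: "spider_semigroup \<mu> t f a = (\<integral>y. (\<Sum>k\<in>UNIV. K k y) \<partial>lborel)" .
  then show "0 \<le> spider_semigroup \<mu> t f a"
    by (auto intro!: integral_nonneg_AE sum_nonneg K_nonneg)
  have "ennreal (spider_semigroup \<mu> t f a) = (\<integral>\<^sup>+y. ennreal (\<Sum>k\<in>UNIV. K k y) \<partial>lborel)"
    unfolding eq using int_K K_nonneg
    by (intro nn_integral_eq_integral[symmetric]) (auto intro!: sum_nonneg)
  also have "\<dots> = nn_semigroup \<mu> t (\<lambda>a. ennreal (f a)) a"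
    unfolding nn_semigroup_def
    by (intro nn_integral_cong, subst sum_ennreal[symmetric])
       (auto simp: K_def f ennreal_mult' K_nonneg[unfolded K_def] indicator_spider_kernel_nonneg intro!: sum.cong)
  finally show "ennreal (spider_semigroup \<mu> t f a) = nn_semigroup \<mu> t (\<lambda>a. ennreal (f a)) a" .
qed

lemma nn_semigroup_SUP:
  assumes [measurable]: "\<And>n. F n \<in> borel_measurable borel" and inc: "\<And>a. incseq (\<lambda>n :: nat. F n a)"
  shows "nn_semigroup \<mu> t (\<lambda>a. SUP n. F n a) a = (SUP n. nn_semigroup \<mu> t (F n) a)"
proof -
  have "nn_semigroup \<mu> t (\<lambda>a. SUP n. F n a) a =
      (\<integral>\<^sup>+ y. (SUP n. \<Sum>k\<in>UNIV. ennreal (indicator {0<..} y * spider_kernel \<mu> t a k y) * F n (spoke k y)) \<partial>lborel)"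
    unfolding nn_semigroup_def
    by (intro nn_integral_cong, subst ennreal_SUP_sum)
       (auto simp: SUP_mult_left_ennreal incseq_def intro!: mult_left_mono inc[THEN incseqD])
  also have "\<dots> = (SUP n. nn_semigroup \<mu> t (F n) a)"
    unfolding nn_semigroup_def
    by (intro nn_integral_monotone_convergence_SUP)
       (auto simp: incseq_def le_fun_def intro!: sum_mono mult_left_mono inc[THEN incseqD])
  finally show ?thesis .
qed

context
  fixes \<mu> :: "'e::finite pmf" and W :: "(real \<Rightarrow> 'e spider) measure"
  assumes W: "brownian_spider \<mu> junction W"
begin

lemma path_law_brownian_spider: "path_law W"
  using W by (simp add: brownian_spider_def)

interpretation W: prob_space W
  by (rule prob_space_path_law[OF path_law_brownian_spider])

lemma brownian_spider_Markov_bounded: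
  assumes s: "0 \<le> s" and "0 < t" and A: "A \<in> sets (path_filtration s)"
    and [measurable]: "f \<in> borel_measurable borel" and f: "\<And>a. 0 \<le> f a" "\<And>a. f a \<le> B"
  shows "(\<integral>\<^sup>+ \<omega>. ennreal (f (\<omega> (s + t))) * indicator A \<omega> \<partial>W)
       = (\<integral>\<^sup>+ \<omega>. nn_semigroup \<mu> t (\<lambda>a. ennreal (f a)) (\<omega> s) * indicator A \<omega> \<partial>W)"
proof -
  interpret finite_measure_subalgebra W "path_filtration s"
    by (unfold_locales) (rule subalgebra_path_filtration[OF path_law_brownian_spider s])
  have [measurable]: "A \<in> sets W"
    using path_filtration_sets_path_law[OF path_law_brownian_spider s A] .
  let ?f = "\<lambda>\<omega>. f (\<omega> (s + t))" and ?P = "\<lambda>\<omega>. spider_semigroup \<mu> t f (\<omega> s)"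
  let ?C = "real_cond_exp W (path_filtration s) ?f"
  have P: "0 \<le> spider_semigroup \<mu> t f a"
    "ennreal (spider_semigroup \<mu> t f a) = nn_semigroup \<mu> t (\<lambda>a. ennreal (f a)) a" for a
    by (rule spider_semigroup_eq_nn_semigroup[OF _ f \<open>0 < t\<close>], measurable)+
  have "spider_semigroup \<mu> t f = (\<lambda>a. enn2real (nn_semigroup \<mu> t (\<lambda>a. ennreal (f a)) a))"
    using P by (metis enn2real_ennreal)
  then have [measurable]: "spider_semigroup \<mu> t f \<in> borel_measurable borel"
    by simp
  have [measurable]: "?f \<in> borel_measurable W" "?P \<in> borel_measurable W"
    using s \<open>0 < t\<close>
    by (auto intro!: measurable_compose[OF measurable_eval[OF path_law_brownian_spider]])
  have int: "integrable W ?f"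
    by (rule W.integrable_const_bound[where B = B]) (use f in auto)
  have "bounded (range f)"
    using f by (intro boundedI[where B = B]) auto
  then have AE: "AE \<omega> in W. ?C \<omega> = ?P \<omega>"
    using W s \<open>0 < t\<close> by (auto simp: brownian_spider_def)
  have intP: "integrable W ?P"
    using AE real_cond_exp_int(1)[OF int] by (subst integrable_cong_AE[where g = ?C]) (auto elim: eventually_mono)
  have "(\<integral>\<^sup>+ \<omega>. ennreal (?f \<omega>) * indicator A \<omega> \<partial>W) = ennreal (\<integral>\<omega>\<in>A. ?f \<omega> \<partial>W)"
    using int f by (intro nn_set_integral_eq_set_integral) (auto simp: set_integrable_def)
  also have "(\<integral>\<omega>\<in>A. ?f \<omega> \<partial>W) = (\<integral>\<omega>\<in>A. ?C \<omega> \<partial>W)"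
    by (rule real_cond_exp_intA[OF int A])
  also have "\<dots> = (\<integral>\<omega>\<in>A. ?P \<omega> \<partial>W)"
    using AE by (intro set_lebesgue_integral_cong_AE) (auto elim: eventually_mono)
  also have "ennreal \<dots> = (\<integral>\<^sup>+ \<omega>. ennreal (?P \<omega>) * indicator A \<omega> \<partial>W)"
    using intP P(1) by (intro nn_set_integral_eq_set_integral[symmetric]) (auto simp: set_integrable_def)
  finally show ?thesis by (simp add: P)
qed

text \<open>Truncation at level \<open>n\<close> reduces the claim to bounded functions, for which the Markov property is
  part of the definition; monotone convergence on both sides removes the truncation.\<close>

lemma brownian_spider_Markov:
  assumes s: "0 \<le> s" and "0 < t" and A: "A \<in> sets (path_filtration s)"
    and [measurable]: "F \<in> borel_measurable borel"
  shows "(\<integral>\<^sup>+ \<omega>. F (\<omega> (s + t)) * indicator A \<omega> \<partial>W)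
       = (\<integral>\<^sup>+ \<omega>. nn_semigroup \<mu> t F (\<omega> s) * indicator A \<omega> \<partial>W)"
proof -
  have [measurable]: "A \<in> sets W"
    using path_filtration_sets_path_law[OF path_law_brownian_spider s A] .
  have [measurable]: "(\<lambda>\<omega>. \<omega> s) \<in> W \<rightarrow>\<^sub>M borel" "(\<lambda>\<omega>. \<omega> (s + t)) \<in> W \<rightarrow>\<^sub>M borel"
    using measurable_eval[OF path_law_brownian_spider] s \<open>0 < t\<close> by auto
  define G where "G n a = min (F a) (ennreal (real n))" for n a
  have [measurable]: "G n \<in> borel_measurable borel" for n
    unfolding G_def[abs_def] by measurable
  have inc: "incseq (\<lambda>n. G n a)" for a
    unfolding incseq_def G_def by (intro allI impI min.mono ennreal_leI) auto
  have F: "(SUP n. G n a) = F a" for a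
  proof -
    have "(SUP n. G n a) = inf (F a) (SUP n. ennreal (real n))"
      unfolding G_def inf_min[symmetric] inf_SUP ..
    then show ?thesis by (simp add: ennreal_SUP_of_nat_eq_top flip: ennreal_of_nat_eq_real_of_nat)
  qed
  have G: "(\<integral>\<^sup>+ \<omega>. G n (\<omega> (s + t)) * indicator A \<omega> \<partial>W)
       = (\<integral>\<^sup>+ \<omega>. nn_semigroup \<mu> t (G n) (\<omega> s) * indicator A \<omega> \<partial>W)" for n
  proof -
    have G: "G n a = ennreal (enn2real (G n a))" for a
      by (subst ennreal_enn2real) (auto simp: G_def min_less_iff_disj)
    have "enn2real (G n a) \<le> real n" for a
      by (intro enn2real_leI) (auto simp: G_def)
    then show ?thesis
      using brownian_spider_Markov_bounded[OF s \<open>0 < t\<close> A, of "\<lambda>a. enn2real (G n a)" "real n"]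
      unfolding G[symmetric] by simp
  qed
  have mono: "nn_semigroup \<mu> t (G m) a \<le> nn_semigroup \<mu> t (G n) a" if "m \<le> n" for m n a
    unfolding nn_semigroup_def
    by (intro nn_integral_mono sum_mono mult_left_mono inc[THEN incseqD] that) auto
  have "(\<integral>\<^sup>+ \<omega>. F (\<omega> (s + t)) * indicator A \<omega> \<partial>W)
      = (\<integral>\<^sup>+ \<omega>. (SUP n. G n (\<omega> (s + t)) * indicator A \<omega>) \<partial>W)"
    by (simp add: SUP_mult_right_ennreal[symmetric] F)
  also have "\<dots> = (SUP n. \<integral>\<^sup>+ \<omega>. G n (\<omega> (s + t)) * indicator A \<omega> \<partial>W)"
    using s \<open>0 < t\<close>
    by (intro nn_integral_monotone_convergence_SUP)
       (auto simp: incseq_def le_fun_def intro!: mult_right_mono inc[THEN incseqD])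
  also have "\<dots> = (SUP n. \<integral>\<^sup>+ \<omega>. nn_semigroup \<mu> t (G n) (\<omega> s) * indicator A \<omega> \<partial>W)"
    by (simp add: G)
  also have "\<dots> = (\<integral>\<^sup>+ \<omega>. (SUP n. nn_semigroup \<mu> t (G n) (\<omega> s) * indicator A \<omega>) \<partial>W)"
    using s
    by (intro nn_integral_monotone_convergence_SUP[symmetric])
       (auto simp: incseq_def le_fun_def intro!: mult_right_mono mono)
  also have "\<dots> = (\<integral>\<^sup>+ \<omega>. nn_semigroup \<mu> t (\<lambda>a. SUP n. G n a) (\<omega> s) * indicator A \<omega> \<partial>W)"
    by (subst nn_semigroup_SUP) (auto simp: inc SUP_mult_right_ennreal)
  finally show ?thesis by (simp add: F)
qed

lemma brownian_spider_law:
  assumes "0 < t" and [measurable]: "F \<in> borel_measurable borel"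
  shows "(\<integral>\<^sup>+ \<omega>. F (\<omega> t) \<partial>W) = nn_semigroup \<mu> t F junction"
proof -
  have "(\<integral>\<^sup>+ \<omega>. F (\<omega> t) \<partial>W) = (\<integral>\<^sup>+ \<omega>. F (\<omega> (0 + t)) * indicator paths \<omega> \<partial>W)"
    by (intro nn_integral_cong) (simp add: space_path_law[OF path_law_brownian_spider])
  also have "\<dots> = (\<integral>\<^sup>+ \<omega>. nn_semigroup \<mu> t F (\<omega> 0) * indicator paths \<omega> \<partial>W)"
    using sets.top[of "path_filtration 0"] \<open>0 < t\<close> by (intro brownian_spider_Markov) auto
  also have "\<dots> = (\<integral>\<^sup>+ \<omega>. nn_semigroup \<mu> t F junction \<partial>W)"
    using W by (intro nn_integral_cong_AE)
      (auto simp: brownian_spider_def space_path_law[OF path_law_brownian_spider] elim: eventually_mono)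
  finally show ?thesis by (simp add: W.emeasure_space_1)
qed

end

text \<open>The spider seen from leg \<open>j\<close>: the leg becomes the positive half-line, and reflection at the
  junction puts twice the mean over all legs minus the value on leg \<open>j\<close> on the negative half-line.\<close>

definition unfold_at :: "'e::finite pmf \<Rightarrow> ('e spider \<Rightarrow> real) \<Rightarrow> 'e \<Rightarrow> real \<Rightarrow> real" where
  "unfold_at \<mu> F j y = (if 0 \<le> y then F (spoke j y)
     else 2 * (\<Sum>k\<in>UNIV. pmf \<mu> k * F (spoke k (- y))) - F (spoke j (- y)))"

lemma spider_kernel_sum:
  assumes "0 \<le> x"
  shows "(\<Sum>k\<in>UNIV. spider_kernel \<mu> t (spoke j x) k y * u k)
       = normal_density 0 (sqrt t) (x - y) * u j
         + normal_density 0 (sqrt t) (x + y) * (2 * (\<Sum>k\<in>UNIV. pmf \<mu> k * u k) - u j)"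
proof -
  let ?p = "normal_density 0 (sqrt t)"
  have eq: "spider_kernel \<mu> t (spoke j x) k y * u k
      = 2 * ?p (x + y) * (pmf \<mu> k * u k) + (if j = k then (?p (x - y) - ?p (x + y)) * u j else 0)" for k
  proof (cases "x = 0")
    case True
    then show ?thesis by (simp add: spider_kernel_def Let_def normal_density_def)
  next
    case False
    then show ?thesis using assms
      by (auto simp: spider_kernel_def Let_def leg_spoke algebra_simps)
  qed
  show ?thesis
    unfolding eq by (simp add: sum.distrib flip: sum_distrib_left) (simp add: algebra_simps)
qed

lemma nn_semigroup_eq_integral:
  assumes F: "\<And>a. 0 \<le> F a"
  shows "nn_semigroup \<mu> t (\<lambda>a. ennreal (F a)) a
    = (\<integral>\<^sup>+y. ennreal (indicator {0<..} y * (\<Sum>k\<in>UNIV. spider_kernel \<mu> t a k y * F (spoke k y))) \<partial>lborel)"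
  unfolding nn_semigroup_def
proof (intro nn_integral_cong)
  fix y :: real
  have nonneg: "0 \<le> indicator {0<..} y * spider_kernel \<mu> t a k y * F (spoke k y)" for k
    using indicator_spider_kernel_nonneg F by (rule mult_nonneg_nonneg)
  have "(\<Sum>k\<in>UNIV. ennreal (indicator {0<..} y * spider_kernel \<mu> t a k y) * ennreal (F (spoke k y)))
      = (\<Sum>k\<in>UNIV. ennreal (indicator {0<..} y * spider_kernel \<mu> t a k y * F (spoke k y)))"
    by (intro sum.cong refl ennreal_mult[symmetric] indicator_spider_kernel_nonneg F)
  also have "\<dots> = ennreal (\<Sum>k\<in>UNIV. indicator {0<..} y * spider_kernel \<mu> t a k y * F (spoke k y))"
    by (rule sum_ennreal) (rule nonneg)
  finally show "(\<Sum>k\<in>UNIV. ennreal (indicator {0<..} y * spider_kernel \<mu> t a k y) * ennreal (F (spoke k y)))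
      = ennreal (indicator {0<..} y * (\<Sum>k\<in>UNIV. spider_kernel \<mu> t a k y * F (spoke k y)))"
    by (simp add: sum_distrib_left mult.assoc)
qed

text \<open>Folding the Gaussian convolution over the line back to the half-line produces exactly the sum of
  the kernels over all legs.  At \<open>x = 0\<close> the choice of \<open>j\<close> does not matter.\<close>

lemma nn_semigroup_unfold_at:
  assumes F: "\<And>a. 0 \<le> F a" and "0 \<le> x"
    and int: "has_bochner_integral lborel (\<lambda>y. normal_density 0 (sqrt t) (x - y) * unfold_at \<mu> F j y) I"
  shows "0 \<le> I" and "nn_semigroup \<mu> t (\<lambda>a. ennreal (F a)) (spoke j x) = ennreal I"
proof -
  let ?q = "\<lambda>y. indicator {0<..} y * (\<Sum>k\<in>UNIV. spider_kernel \<mu> t (spoke j x) k y * F (spoke k y))"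
  have nonneg: "0 \<le> ?q y" for y
    by (auto simp: indicator_def intro!: sum_nonneg mult_nonneg_nonneg spider_kernel_nonneg F)
  have "?q = (\<lambda>y. indicator {0<..} y * (normal_density 0 (sqrt t) (x - y) * unfold_at \<mu> F j y
      + normal_density 0 (sqrt t) (x - (- y)) * unfold_at \<mu> F j (- y)))"
    unfolding spider_kernel_sum[OF \<open>0 \<le> x\<close>]
    by (auto simp: fun_eq_iff unfold_at_def indicator_def)
  then have "has_bochner_integral lborel ?q I"
    using has_bochner_integral_fold[OF int] by simp
  then show "0 \<le> I" "nn_semigroup \<mu> t (\<lambda>a. ennreal (F a)) (spoke j x) = ennreal I"
    unfolding nn_semigroup_eq_integral[OF F]
    using nonneg by (auto simp: has_bochner_integral_iff nn_integral_eq_integral intro!: integral_nonneg_AE)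
qed

section \<open>Penalization by an exponential weight on one leg\<close>

lemma set_integrable_if_integrable:
  fixes f :: "_ \<Rightarrow> real"
  shows "integrable M f \<Longrightarrow> A \<in> sets M \<Longrightarrow> set_integrable M A f"
  unfolding set_integrable_def by (rule integrable_mult_indicator)

text \<open>Domination by a measure carries its continuity at the empty set over to \<open>q\<close>, which is what
  Caratheodory's extension theorem requires of a finitely additive set function.\<close>

lemma path_law_extension:
  fixes q :: "(real \<Rightarrow> 'e spider) set \<Rightarrow> real"
  assumes "path_law \<nu>" and "0 < w"
    and dom: "\<And>A. A \<in> cylinders \<Longrightarrow> w * q A \<le> measure \<nu> A"
    and nonneg: "\<And>A. A \<in> cylinders \<Longrightarrow> 0 \<le> q A"
    and add: "\<And>A B. A \<in> cylinders \<Longrightarrow> B \<in> cylinders \<Longrightarrow> A \<inter> B = {} \<Longrightarrow> q (A \<union> B) = q A + q B"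
    and one: "q paths = 1"
  obtains Q where "path_law Q" "\<And>A. A \<in> cylinders \<Longrightarrow> measure Q A = q A"
proof -
  interpret \<nu>: prob_space \<nu> using \<open>path_law \<nu>\<close> by (rule prob_space_path_law)
  interpret algebra "paths :: (real \<Rightarrow> 'e spider) set" cylinders by (rule algebra_cylinders)
  have empty: "q {} = 0" using add[of "{}" "{}"] by simp
  have "\<exists>\<mu>' :: (real \<Rightarrow> 'e spider) set \<Rightarrow> ennreal. (\<forall>A\<in>cylinders. \<mu>' A = ennreal (q A)) \<and> measure_space paths (sigma_sets paths cylinders) \<mu>'"
  proof (rule caratheodory_empty_continuous)
    show "positive cylinders (\<lambda>A. ennreal (q A))" by (simp add: positive_def empty)
    show "additive cylinders (\<lambda>A. ennreal (q A))"
      by (auto simp: additive_def add nonneg ennreal_plus)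
    fix A :: "nat \<Rightarrow> (real \<Rightarrow> 'e spider) set"
    assume A: "range A \<subseteq> cylinders" "decseq A" "(\<Inter>i. A i) = {}"
    then have "(\<lambda>i. measure \<nu> (A i)) \<longlonglongrightarrow> measure \<nu> (\<Inter>i. A i)"
      using cylinders_path_law[OF \<open>path_law \<nu>\<close>] by (intro \<nu>.finite_Lim_measure_decseq) auto
    then have "(\<lambda>i. measure \<nu> (A i) / w) \<longlonglongrightarrow> measure \<nu> (\<Inter>i. A i) / w"
      using \<open>0 < w\<close> by (intro tendsto_divide tendsto_const) auto
    then have "(\<lambda>i. measure \<nu> (A i) / w) \<longlonglongrightarrow> 0"
      unfolding A by simp
    then have "(\<lambda>i. q (A i)) \<longlonglongrightarrow> 0"
    proof (rule tendsto_sandwich[OF _ _ tendsto_const, rotated 2])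
      have "A i \<in> cylinders" for i using A(1) by auto
      then show "\<forall>\<^sub>F i in sequentially. 0 \<le> q (A i)"
        "\<forall>\<^sub>F i in sequentially. q (A i) \<le> measure \<nu> (A i) / w"
        using dom nonneg \<open>0 < w\<close> by (simp_all add: pos_le_divide_eq mult.commute)
    qed
    then show "(\<lambda>i. ennreal (q (A i))) \<longlonglongrightarrow> 0"
      using tendsto_ennrealI[of "\<lambda>i. q (A i)" 0 sequentially] by simp
  qed simp
  then obtain \<mu>' where eq: "\<And>A. A \<in> cylinders \<Longrightarrow> \<mu>' A = ennreal (q A)"
    and space: "measure_space paths (sigma_sets paths cylinders) \<mu>'"
    by blast
  define Q where "Q = measure_of paths (sigma_sets paths cylinders) \<mu>'"
  have sets: "sets Q = sigma_sets paths cylinders" and [simp]: "space Q = paths"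
    using sigma_sets_into_sp[OF cylinders_subset] cylinders_subset
    by (auto simp: Q_def sigma_algebra.sets_measure_of_eq[OF sigma_algebra_sigma_sets[OF cylinders_subset]] space_measure_of_conv)
  have Q: "emeasure Q A = ennreal (q A)" if "A \<in> cylinders" for A
    using space that
    by (subst eq[OF that, symmetric])
       (auto simp: Q_def measure_space_def intro!: emeasure_measure_of_sigma)
  show thesis
  proof (rule that)
    show "path_law Q"
      using Q[OF top] by (auto simp: path_law_def sets sets_path_algebra one intro!: prob_spaceI)
    show "measure Q A = q A" if "A \<in> cylinders" for A
      using Q[OF that] nonneg[OF that] by (simp add: measure_def)
  qed
qed

text \<open>A path law is determined by its values on the cylinders, so the limits leave no choice.\<close>

lemma penalized_limit_eqI:
  assumes Q: "path_law Q"
    and lim: "\<And>A. A \<in> cylinders \<Longrightarrow> ((\<lambda>t. measure (penalized W \<alpha> t) A) \<longlongrightarrow> measure Q A) at_top"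
  shows "penalized_limit W \<alpha> = Q"
  unfolding penalized_limit_def
proof (rule the_equality)
  show "path_law Q \<and> (\<forall>s\<ge>0. \<forall>A\<in>sets (path_filtration s).
      ((\<lambda>t. measure (penalized W \<alpha> t) A) \<longlongrightarrow> measure Q A) at_top)"
    using Q lim by (auto intro: cylindersI)
  fix R assume R: "path_law R \<and> (\<forall>s\<ge>0. \<forall>A\<in>sets (path_filtration s).
      ((\<lambda>t. measure (penalized W \<alpha> t) A) \<longlongrightarrow> measure R A) at_top)"
  show "R = Q"
  proof (rule path_law_eqI)
    fix A :: "(real \<Rightarrow> 'a spider) set" assume A: "A \<in> cylinders"
    then have "((\<lambda>t. measure (penalized W \<alpha> t) A) \<longlongrightarrow> measure R A) at_top"
      using R by (auto simp: cylinders_def)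
    with lim[OF A] show "measure R A = measure Q A"
      by (intro tendsto_unique[OF trivial_limit_at_top_linorder])
  qed (use R Q in auto)
qed

text \<open>The density of the penalized limit, up to the factor \<open>exp (- b\<^sup>2 * s / 2)\<close>.  These functions are the
  extremal nonnegative eigenfunctions of the semigroup for the eigenvalue \<open>exp (b\<^sup>2 * t / 2)\<close>,
  normalized at the junction.\<close>

definition leg_harmonic :: "'e pmf \<Rightarrow> real \<Rightarrow> 'e \<Rightarrow> 'e spider \<Rightarrow> real" where
  "leg_harmonic \<mu> b m a =
     exp (- b * radius a) + (if leg a = Some m then sinh (b * radius a) / pmf \<mu> m else 0)"

lemma leg_harmonic_spoke:
  "0 \<le> y \<Longrightarrow> leg_harmonic \<mu> b m (spoke k y) = exp (- b * y) + (if k = m then sinh (b * y) / pmf \<mu> m else 0)"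
  by (auto simp: leg_harmonic_def leg_spoke)

lemma leg_harmonic_nonneg: "0 \<le> b \<Longrightarrow> 0 \<le> leg_harmonic \<mu> b m a"
  using radius_nonneg[of a] by (auto simp: leg_harmonic_def)

lemma borel_measurable_leg_harmonic [measurable]:
  "leg_harmonic \<mu> b (m :: 'e::finite) \<in> borel_measurable borel"
proof (rule borel_measurable_spiderI)
  have "(\<lambda>y. leg_harmonic \<mu> b m (spoke k y))
      = (\<lambda>y. exp (- b * max 0 y) + (if k = m then sinh (b * max 0 y) / pmf \<mu> m else 0))" for k
    by (auto simp: fun_eq_iff leg_harmonic_def leg_spoke)
  then show "(\<lambda>y. leg_harmonic \<mu> b m (spoke k y)) \<in> borel_measurable borel" for k
    by (cases "k = m") (simp_all add: sinh_def)
qed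

lemma borel_measurable_leg_weight [measurable]:
  "leg_weight (\<alpha> :: 'e::finite \<Rightarrow> real) \<in> borel_measurable borel"
proof (rule borel_measurable_spiderI)
  have "(\<lambda>y. leg_weight \<alpha> (spoke k y)) = (\<lambda>y. \<alpha> k * max 0 y)" for k
    by (auto simp: fun_eq_iff leg_weight_def leg_spoke)
  then show "(\<lambda>y. leg_weight \<alpha> (spoke k y)) \<in> borel_measurable borel" for k
    by simp
qed

text \<open>The mean over the legs is \<open>exp (- b * z) + sinh (b * z) = cosh (b * z)\<close>; hence the unfolded function
  is given by one hyperbolic expression on both half-lines, without a kink at the junction.\<close>

lemma unfold_at_leg_harmonic:
  assumes "0 < pmf \<mu> m"
  shows "unfold_at \<mu> (leg_harmonic \<mu> b m) j y
       = cosh (b * y) + ((if j = m then 1 / pmf \<mu> m else 0) - 1) * sinh (b * y)"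
proof -
  have mean: "(\<Sum>k\<in>UNIV. pmf \<mu> k * leg_harmonic \<mu> b m (spoke k z)) = cosh (b * z)" if "0 \<le> z" for z
  proof -
    have "pmf \<mu> k * leg_harmonic \<mu> b m (spoke k z)
        = exp (- b * z) * pmf \<mu> k + (if k = m then sinh (b * z) else 0)" for k
      using that assms by (simp add: leg_harmonic_spoke algebra_simps)
    then have "(\<Sum>k\<in>UNIV. pmf \<mu> k * leg_harmonic \<mu> b m (spoke k z)) = exp (- b * z) * (\<Sum>k\<in>UNIV. pmf \<mu> k) + sinh (b * z)"
      by (simp add: sum.distrib sum_distrib_left)
    then show ?thesis
      by (simp add: sum_pmf_eq_1 cosh_def sinh_def field_simps)
  qed
  show ?thesis
  proof (cases "0 \<le> y")
    case True
    then show ?thesis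
      using cosh_minus_sinh[of "b * y"]
      by (auto simp: unfold_at_def leg_harmonic_spoke algebra_simps)
  next
    case False
    then show ?thesis
      using mean[of "- y"] cosh_plus_sinh[of "b * y"]
      by (auto simp: unfold_at_def leg_harmonic_spoke algebra_simps)
  qed
qed

lemma nn_semigroup_leg_harmonic:
  assumes "0 < pmf \<mu> m" "0 \<le> b" "0 < t"
  shows "nn_semigroup \<mu> t (\<lambda>a. ennreal (leg_harmonic \<mu> b m a)) a
       = ennreal (exp (b\<^sup>2 * t / 2)) * ennreal (leg_harmonic \<mu> b m a)"
proof -
  let ?j = "the (leg a)" and ?x = "radius a"
  have "unfold_at \<mu> (leg_harmonic \<mu> b m) ?j ?x = leg_harmonic \<mu> b m a"
    using radius_nonneg[of a] by (simp add: unfold_at_def)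
  moreover have "has_bochner_integral lborel
      (\<lambda>y. normal_density 0 (sqrt t) (?x - y) * unfold_at \<mu> (leg_harmonic \<mu> b m) ?j y)
      (exp (b\<^sup>2 * t / 2) * unfold_at \<mu> (leg_harmonic \<mu> b m) ?j ?x)"
    unfolding unfold_at_leg_harmonic[OF assms(1)]
    using \<open>0 < t\<close> by (rule has_bochner_integral_gaussian_hyperbolic)
  ultimately have "has_bochner_integral lborel
      (\<lambda>y. normal_density 0 (sqrt t) (?x - y) * unfold_at \<mu> (leg_harmonic \<mu> b m) ?j y)
      (exp (b\<^sup>2 * t / 2) * leg_harmonic \<mu> b m a)"
    by simp
  from nn_semigroup_unfold_at(2)[OF leg_harmonic_nonneg[OF \<open>0 \<le> b\<close>] radius_nonneg this]
  show ?thesis by (simp add: ennreal_mult')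
qed

text \<open>On leg \<open>m\<close> the exponentially growing parts cancel, because \<open>2 * sinh x = exp x - exp (- x)\<close>; on the
  other legs both terms are bounded.\<close>

lemma leg_weight_asymp:
  assumes "0 < pmf \<mu> m" "0 \<le> b"
  shows "\<bar>exp (leg_weight (\<lambda>m'. if m' = m then b else 0) a) - 2 * pmf \<mu> m * leg_harmonic \<mu> b m a\<bar> \<le> 1"
proof -
  have e: "0 \<le> exp (- (b * radius a))" "exp (- (b * radius a)) \<le> 1"
    using \<open>0 \<le> b\<close> radius_nonneg[of a] by auto
  have \<mu>: "0 \<le> pmf \<mu> m" "pmf \<mu> m \<le> 1" by (auto simp: pmf_le_1)
  have prod: "0 \<le> pmf \<mu> m * exp (- (b * radius a))" "pmf \<mu> m * exp (- (b * radius a)) \<le> exp (- (b * radius a))"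
    using e \<mu> by (auto intro: mult_left_le_one_le)
  show ?thesis
  proof (cases "leg a = Some m")
    case True
    then have "exp (leg_weight (\<lambda>m'. if m' = m then b else 0) a) - 2 * pmf \<mu> m * leg_harmonic \<mu> b m a
        = exp (- (b * radius a)) - 2 * (pmf \<mu> m * exp (- (b * radius a)))"
      using assms by (simp add: leg_weight_def leg_harmonic_def sinh_def field_simps)
    then show ?thesis using e prod by linarith
  next
    case False
    then have "leg_weight (\<lambda>m'. if m' = m then b else 0) a = 0"
      by (auto simp: leg_weight_def split: option.split)
    then show ?thesis
      using False e prod unfolding leg_harmonic_def by (simp add: abs_le_iff mult.assoc, linarith)
  qed
qed

context
  fixes \<mu> :: "'e::finite pmf" and W :: "(real \<Rightarrow> 'e spider) measure" and b :: real and m :: 'e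
  assumes W: "brownian_spider \<mu> junction W" and \<mu>: "0 < pmf \<mu> m" and b: "0 < b"
begin

interpretation W: prob_space W
  by (rule prob_space_path_law[OF path_law_brownian_spider[OF W]])

lemma brownian_spider_AE_0: "AE \<omega> in W. \<omega> 0 = junction"
  using W by (simp add: brownian_spider_def)

lemma leg_harmonic_martingale_nn:
  assumes "0 \<le> s" "s \<le> t" "A \<in> sets (path_filtration s)"
  shows "(\<integral>\<^sup>+ \<omega>. ennreal (leg_harmonic \<mu> b m (\<omega> t)) * indicator A \<omega> \<partial>W)
       = ennreal (exp (b\<^sup>2 * (t - s) / 2)) * (\<integral>\<^sup>+ \<omega>. ennreal (leg_harmonic \<mu> b m (\<omega> s)) * indicator A \<omega> \<partial>W)"
proof (cases "s = t")
  case False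
  have [measurable]: "A \<in> sets W" "(\<lambda>\<omega>. \<omega> s) \<in> W \<rightarrow>\<^sub>M borel"
    using path_filtration_sets_path_law measurable_eval path_law_brownian_spider[OF W] assms by auto
  show ?thesis
    using brownian_spider_Markov[OF W, of s "t - s" A "\<lambda>a. ennreal (leg_harmonic \<mu> b m a)"] assms False \<mu> b
    by (simp add: nn_semigroup_leg_harmonic mult.assoc nn_integral_cmult)
qed simp

lemma has_bochner_integral_leg_harmonic:
  assumes "0 \<le> t"
  shows "has_bochner_integral W (\<lambda>\<omega>. leg_harmonic \<mu> b m (\<omega> t)) (exp (b\<^sup>2 * t / 2))"
proof (rule has_bochner_integral_nn_integral)
  show "(\<lambda>\<omega>. leg_harmonic \<mu> b m (\<omega> t)) \<in> borel_measurable W"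
    using measurable_eval[OF path_law_brownian_spider[OF W] assms] by measurable
  have start: "AE \<omega> in W. ennreal (leg_harmonic \<mu> b m (\<omega> 0)) * indicator paths \<omega> = 1"
    using brownian_spider_AE_0 AE_space
    by eventually_elim (simp add: leg_harmonic_def space_path_law[OF path_law_brownian_spider[OF W]])
  have "(\<integral>\<^sup>+ \<omega>. ennreal (leg_harmonic \<mu> b m (\<omega> t)) \<partial>W) =
      (\<integral>\<^sup>+ \<omega>. ennreal (leg_harmonic \<mu> b m (\<omega> t)) * indicator paths \<omega> \<partial>W)"
    by (intro nn_integral_cong) (simp add: space_path_law[OF path_law_brownian_spider[OF W]])
  also have "\<dots> = ennreal (exp (b\<^sup>2 * t / 2)) * (\<integral>\<^sup>+ \<omega>. ennreal (leg_harmonic \<mu> b m (\<omega> 0)) * indicator paths \<omega> \<partial>W)"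
    using leg_harmonic_martingale_nn[of 0 t paths] assms sets.top[of "path_filtration 0"] by simp
  also have "(\<integral>\<^sup>+ \<omega>. ennreal (leg_harmonic \<mu> b m (\<omega> 0)) * indicator paths \<omega> \<partial>W) = 1"
    using start by (subst nn_integral_cong_AE[where v = "\<lambda>_. 1"]) (auto simp: W.emeasure_space_1)
  finally show "(\<integral>\<^sup>+ \<omega>. ennreal (leg_harmonic \<mu> b m (\<omega> t)) \<partial>W) = ennreal (exp (b\<^sup>2 * t / 2))"
    by simp
qed (use b in \<open>auto simp: leg_harmonic_nonneg\<close>)

lemma set_integral_leg_harmonic_paths:
  "0 \<le> t \<Longrightarrow> (\<integral>\<omega>\<in>paths. leg_harmonic \<mu> b m (\<omega> t) \<partial>W) = exp (b\<^sup>2 * t / 2)"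
  using has_bochner_integral_leg_harmonic[of t] set_integral_space[of W "\<lambda>\<omega>. leg_harmonic \<mu> b m (\<omega> t)"]
  by (simp add: has_bochner_integral_iff space_path_law[OF path_law_brownian_spider[OF W]])

lemma leg_harmonic_martingale:
  assumes "0 \<le> s" "s \<le> t" "A \<in> sets (path_filtration s)"
  shows "(\<integral>\<omega>\<in>A. leg_harmonic \<mu> b m (\<omega> t) \<partial>W) = exp (b\<^sup>2 * (t - s) / 2) * (\<integral>\<omega>\<in>A. leg_harmonic \<mu> b m (\<omega> s) \<partial>W)"
proof -
  have A: "A \<in> sets W"
    using path_filtration_sets_path_law path_law_brownian_spider[OF W] assms by auto
  have "(\<integral>\<^sup>+ \<omega>. ennreal (leg_harmonic \<mu> b m (\<omega> u)) * indicator A \<omega> \<partial>W) = ennreal (\<integral>\<omega>\<in>A. leg_harmonic \<mu> b m (\<omega> u) \<partial>W)"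
    if "0 \<le> u" for u
    using has_bochner_integral_leg_harmonic[OF that] A b
    by (intro nn_set_integral_eq_set_integral)
       (auto simp: has_bochner_integral_iff leg_harmonic_nonneg intro!: set_integrable_if_integrable)
  then have "ennreal (\<integral>\<omega>\<in>A. leg_harmonic \<mu> b m (\<omega> t) \<partial>W)
      = ennreal (exp (b\<^sup>2 * (t - s) / 2) * (\<integral>\<omega>\<in>A. leg_harmonic \<mu> b m (\<omega> s) \<partial>W))"
    using leg_harmonic_martingale_nn[OF assms] assms by (simp add: ennreal_mult')
  moreover have "0 \<le> (\<integral>\<omega>\<in>A. leg_harmonic \<mu> b m (\<omega> u) \<partial>W)" for u
    using b unfolding set_lebesgue_integral_def
    by (intro Bochner_Integration.integral_nonneg) (auto simp: leg_harmonic_nonneg)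
  ultimately show ?thesis by simp
qed

abbreviation (input) weight :: "(real \<Rightarrow> 'e spider) \<Rightarrow> real \<Rightarrow> real" where
  "weight \<omega> t \<equiv> exp (leg_weight (\<lambda>m'. if m' = m then b else 0) (\<omega> t))"

text \<open>The weight is replaced by a multiple of \<open>leg_harmonic\<close> at the price of an error of at most one, and
  the martingale property moves the time from \<open>t\<close> back to \<open>s\<close>.\<close>

lemma integral_weight_asymp:
  assumes "0 \<le> s" "s \<le> t" "A \<in> sets (path_filtration s)"
  shows "integrable W (\<lambda>\<omega>. weight \<omega> t)"
    and "\<bar>(\<integral>\<omega>\<in>A. weight \<omega> t \<partial>W) - 2 * pmf \<mu> m * exp (b\<^sup>2 * t / 2) * (exp (- b\<^sup>2 * s / 2) * (\<integral>\<omega>\<in>A. leg_harmonic \<mu> b m (\<omega> s) \<partial>W))\<bar> \<le> 1"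
proof -
  have A: "A \<in> sets W"
    using path_filtration_sets_path_law path_law_brownian_spider[OF W] assms by auto
  have [measurable]: "(\<lambda>\<omega>. \<omega> t) \<in> W \<rightarrow>\<^sub>M borel"
    using measurable_eval[OF path_law_brownian_spider[OF W], of t] assms by simp
  have psi: "integrable W (\<lambda>\<omega>. leg_harmonic \<mu> b m (\<omega> t))"
    using has_bochner_integral_leg_harmonic[of t] assms by (simp add: has_bochner_integral_iff)
  let ?d = "\<lambda>\<omega>. weight \<omega> t - 2 * pmf \<mu> m * leg_harmonic \<mu> b m (\<omega> t)"
  have d: "\<bar>?d \<omega>\<bar> \<le> 1" for \<omega>
    using leg_weight_asymp[OF \<mu>, of b "\<omega> t"] b by simp
  have int_d: "integrable W ?d"
    by (rule W.integrable_const_bound[where B = 1]) (use d in auto)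
  then have "integrable W (\<lambda>\<omega>. ?d \<omega> + 2 * pmf \<mu> m * leg_harmonic \<mu> b m (\<omega> t))"
    using psi by (intro Bochner_Integration.integrable_add) auto
  then show int: "integrable W (\<lambda>\<omega>. weight \<omega> t)" by simp
  have "exp (b\<^sup>2 * t / 2) * exp (- b\<^sup>2 * s / 2) = exp (b\<^sup>2 * (t - s) / 2)"
    unfolding exp_add[symmetric] by (simp add: field_simps)
  then have "(\<integral>\<omega>\<in>A. weight \<omega> t \<partial>W) - 2 * pmf \<mu> m * exp (b\<^sup>2 * t / 2) * (exp (- b\<^sup>2 * s / 2) * (\<integral>\<omega>\<in>A. leg_harmonic \<mu> b m (\<omega> s) \<partial>W))
      = (\<integral>\<omega>\<in>A. weight \<omega> t \<partial>W) - (\<integral>\<omega>\<in>A. 2 * pmf \<mu> m * leg_harmonic \<mu> b m (\<omega> t) \<partial>W)"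
    using leg_harmonic_martingale[OF assms] by (simp add: mult.assoc[symmetric])
  also have "\<dots> = (\<integral>\<omega>\<in>A. ?d \<omega> \<partial>W)"
    using int psi A by (intro set_integral_diff(2)[symmetric]) (auto intro!: set_integrable_if_integrable)
  also have "\<bar>\<dots>\<bar> \<le> (\<integral>\<omega>. 1 \<partial>W)"
    unfolding set_lebesgue_integral_def
  proof (rule integral_abs_bound[THEN order_trans], rule integral_mono)
    show "integrable W (\<lambda>\<omega>. \<bar>indicator A \<omega> *\<^sub>R ?d \<omega>\<bar>)"
      by (intro integrable_abs integrable_mult_indicator A int_d)
    show "\<bar>indicator A \<omega> *\<^sub>R ?d \<omega>\<bar> \<le> 1" for \<omega>
      using d[of \<omega>] by (simp add: indicator_def)
  qed simp
  finally show "\<bar>(\<integral>\<omega>\<in>A. weight \<omega> t \<partial>W) - 2 * pmf \<mu> m * exp (b\<^sup>2 * t / 2) * (exp (- b\<^sup>2 * s / 2) * (\<integral>\<omega>\<in>A. leg_harmonic \<mu> b m (\<omega> s) \<partial>W))\<bar> \<le> 1"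
    by (simp add: W.prob_space)
qed

lemma measure_penalized:
  assumes "0 \<le> t" and A: "A \<in> sets W"
  shows "measure (penalized W (\<lambda>m'. if m' = m then b else 0) t) A = (\<integral>\<omega>\<in>A. weight \<omega> t \<partial>W) / (\<integral>\<omega>. weight \<omega> t \<partial>W)"
proof -
  have [measurable]: "(\<lambda>\<omega>. \<omega> t) \<in> W \<rightarrow>\<^sub>M borel"
    using measurable_eval[OF path_law_brownian_spider[OF W], of t] assms by simp
  let ?Z = "\<integral>\<omega>. weight \<omega> t \<partial>W"
  have int: "integrable W (\<lambda>\<omega>. weight \<omega> t)"
    using integral_weight_asymp(1)[of 0 t "{}"] assms by simp
  have Z: "0 \<le> ?Z" by simp
  have "emeasure (penalized W (\<lambda>m'. if m' = m then b else 0) t) A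
      = (\<integral>\<^sup>+ \<omega>. ennreal (weight \<omega> t / ?Z) * indicator A \<omega> \<partial>W)"
    unfolding penalized_def using A by (subst emeasure_density) auto
  also have "\<dots> = ennreal (\<integral>\<omega>\<in>A. weight \<omega> t / ?Z \<partial>W)"
    using int A Z by (intro nn_set_integral_eq_set_integral) (auto intro!: set_integrable_if_integrable)
  also have "(\<integral>\<omega>\<in>A. weight \<omega> t / ?Z \<partial>W) = (\<integral>\<omega>\<in>A. weight \<omega> t \<partial>W) / ?Z"
    by simp
  finally show ?thesis
    using Z by (simp add: measure_def set_lebesgue_integral_def)
qed

text \<open>Numerator and denominator of the penalized probability, divided by the common growth
  \<open>2 * \<mu>\<^sub>m * exp (b\<^sup>2 * t / 2)\<close>, both converge since their errors are bounded.\<close>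

lemma penalized_tendsto:
  assumes "0 \<le> s" and A: "A \<in> sets (path_filtration s)"
  shows "((\<lambda>t. measure (penalized W (\<lambda>m'. if m' = m then b else 0) t) A)
      \<longlongrightarrow> exp (- b\<^sup>2 * s / 2) * (\<integral>\<omega>\<in>A. leg_harmonic \<mu> b m (\<omega> s) \<partial>W)) at_top"
proof -
  have AW: "A \<in> sets W"
    using path_filtration_sets_path_law path_law_brownian_spider[OF W] assms by auto
  define q where "q t = 2 * pmf \<mu> m * exp (b\<^sup>2 * t / 2)" for t
  have q_pos: "0 < q t" for t using \<mu> by (simp add: q_def)
  have "filterlim (\<lambda>t. 2 * pmf \<mu> m * exp (b\<^sup>2 / 2 * t)) at_top at_top"
    using \<mu> b
    by (intro filterlim_tendsto_pos_mult_at_top[OF tendsto_const] filterlim_compose[OF exp_at_top] filterlim_ident) auto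
  then have "filterlim q at_top at_top"
    by (simp add: q_def[abs_def])
  then have inv: "((\<lambda>t. 1 / q t) \<longlongrightarrow> 0) at_top"
    by (rule tendsto_divide_0[OF tendsto_const filterlim_at_top_imp_at_infinity])
  have ratio: "((\<lambda>t. N t / q t) \<longlongrightarrow> l) at_top" if "\<And>t. s \<le> t \<Longrightarrow> \<bar>N t - q t * l\<bar> \<le> 1" for N l
  proof (rule LIM_zero_cancel, rule Lim_null_comparison[OF _ inv])
    show "\<forall>\<^sub>F t in at_top. norm (N t / q t - l) \<le> 1 / q t"
      using eventually_ge_at_top[of s]
    proof eventually_elim
      case (elim t)
      have "N t / q t - l = (N t - q t * l) / q t" using q_pos[of t] by (simp add: field_simps)
      then show ?case using that[OF elim] q_pos[of t] by (simp add: divide_right_mono)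
    qed
  qed
  have num: "((\<lambda>t. (\<integral>\<omega>\<in>A. weight \<omega> t \<partial>W) / q t) \<longlongrightarrow> exp (- b\<^sup>2 * s / 2) * (\<integral>\<omega>\<in>A. leg_harmonic \<mu> b m (\<omega> s) \<partial>W)) at_top"
    by (rule ratio) (use integral_weight_asymp(2)[OF \<open>0 \<le> s\<close> _ A] in \<open>simp add: q_def\<close>)
  have den: "((\<lambda>t. (\<integral>\<omega>. weight \<omega> t \<partial>W) / q t) \<longlongrightarrow> 1) at_top"
  proof (rule ratio)
    have [simp]: "space W = paths" by (rule space_path_law[OF path_law_brownian_spider[OF W]])
    show "\<bar>(\<integral>\<omega>. weight \<omega> t \<partial>W) - q t * 1\<bar> \<le> 1" if "s \<le> t" for t
      using integral_weight_asymp(2)[of 0 t paths] that \<open>0 \<le> s\<close> sets.top[of "path_filtration 0"]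
        integral_weight_asymp(1)[of 0 t paths] set_integral_space[of W "\<lambda>\<omega>. weight \<omega> t"]
      by (simp add: set_integral_leg_harmonic_paths q_def)
  qed
  have "((\<lambda>t. ((\<integral>\<omega>\<in>A. weight \<omega> t \<partial>W) / q t) / ((\<integral>\<omega>. weight \<omega> t \<partial>W) / q t))
      \<longlongrightarrow> (exp (- b\<^sup>2 * s / 2) * (\<integral>\<omega>\<in>A. leg_harmonic \<mu> b m (\<omega> s) \<partial>W)) / 1) at_top"
    by (intro tendsto_divide num den) simp
  moreover have "\<forall>\<^sub>F t in at_top. ((\<integral>\<omega>\<in>A. weight \<omega> t \<partial>W) / q t) / ((\<integral>\<omega>. weight \<omega> t \<partial>W) / q t)
      = measure (penalized W (\<lambda>m'. if m' = m then b else 0) t) A"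
    using eventually_ge_at_top[of 0]
    by eventually_elim (use q_pos AW in \<open>simp add: measure_penalized less_imp_neq[THEN not_sym]\<close>)
  ultimately show ?thesis
    unfolding div_by_1 by (rule Lim_transform_eventually)
qed

text \<open>The limits along the cylinders inherit finite additivity from the penalized measures; domination by
  \<open>\<nu>\<close> supplies the countable additivity.\<close>

lemma path_law_penalized_limit:
  assumes \<nu>: "path_law \<nu>" and "0 < w"
    and dom: "\<And>s A. 0 \<le> s \<Longrightarrow> A \<in> sets (path_filtration s) \<Longrightarrow>
      w * (exp (- b\<^sup>2 * s / 2) * (\<integral>\<omega>\<in>A. leg_harmonic \<mu> b m (\<omega> s) \<partial>W)) \<le> measure \<nu> A"
  defines "Q \<equiv> penalized_limit W (\<lambda>m'. if m' = m then b else 0)"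
  shows "path_law Q"
    and "\<And>s A. 0 \<le> s \<Longrightarrow> A \<in> sets (path_filtration s) \<Longrightarrow>
      measure Q A = exp (- b\<^sup>2 * s / 2) * (\<integral>\<omega>\<in>A. leg_harmonic \<mu> b m (\<omega> s) \<partial>W)"
proof -
  let ?P = "penalized W (\<lambda>m'. if m' = m then b else 0)"
  define q where "q A = Lim at_top (\<lambda>t. measure (?P t) A)" for A
  have q: "q A = exp (- b\<^sup>2 * s / 2) * (\<integral>\<omega>\<in>A. leg_harmonic \<mu> b m (\<omega> s) \<partial>W)"
    if "0 \<le> s" "A \<in> sets (path_filtration s)" for s A
    unfolding q_def by (intro tendsto_Lim penalized_tendsto that) simp
  have lim: "((\<lambda>t. measure (?P t) A) \<longlongrightarrow> q A) at_top" if "A \<in> cylinders" for A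
    using that penalized_tendsto q by (auto simp: cylinders_def)
  have sets_P: "sets (?P t) = sets W" for t by (simp add: penalized_def)
  obtain Q' where Q': "path_law Q'" "\<And>A. A \<in> cylinders \<Longrightarrow> measure Q' A = q A"
  proof (rule path_law_extension[OF \<nu> \<open>0 < w\<close>])
    show "w * q A \<le> measure \<nu> A" if "A \<in> cylinders" for A
      using that dom q by (auto simp: cylinders_def)
    show "0 \<le> q A" if "A \<in> cylinders" for A
      by (rule tendsto_lowerbound[OF lim[OF that]]) auto
    have "paths \<in> sets (path_filtration 0)" using sets.top[of "path_filtration 0"] by simp
    then show "q paths = 1"
      using q[of 0 paths] by (simp add: set_integral_leg_harmonic_paths)
    show "q (A \<union> B) = q A + q B" if "A \<in> cylinders" "B \<in> cylinders" "A \<inter> B = {}" for A B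
    proof (rule tendsto_unique[OF trivial_limit_at_top_linorder])
      show "((\<lambda>t. measure (?P t) (A \<union> B)) \<longlongrightarrow> q (A \<union> B)) at_top"
        using ring_of_sets.Un[OF algebra.axioms(1)[OF algebra_cylinders]] that lim by auto
      have "((\<lambda>t. measure (?P t) A + measure (?P t) B) \<longlongrightarrow> q A + q B) at_top"
        using that lim by (intro tendsto_add) auto
      moreover have "\<forall>\<^sub>F t in at_top. measure (?P t) A + measure (?P t) B = measure (?P t) (A \<union> B)"
        using eventually_ge_at_top[of 0]
      proof eventually_elim
        case (elim t)
        have sets: "A \<in> sets W" "B \<in> sets W"
          using cylinders_path_law path_law_brownian_spider[OF W] that by auto
        have "integrable W (\<lambda>\<omega>. weight \<omega> t)"
          using integral_weight_asymp(1)[of 0 t "{}"] elim by simp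
        then have "(\<integral>\<omega>\<in>A \<union> B. weight \<omega> t \<partial>W) = (\<integral>\<omega>\<in>A. weight \<omega> t \<partial>W) + (\<integral>\<omega>\<in>B. weight \<omega> t \<partial>W)"
          using sets that by (intro set_integral_Un) (auto intro!: set_integrable_if_integrable)
        then show ?case
          using sets elim by (simp add: measure_penalized add_divide_distrib)
      qed
      ultimately show "((\<lambda>t. measure (?P t) (A \<union> B)) \<longlongrightarrow> q A + q B) at_top"
        by (rule Lim_transform_eventually)
    qed
  qed blast
  have "Q = Q'"
    unfolding Q_def using Q' lim by (intro penalized_limit_eqI) auto
  then show "path_law Q" using Q'(1) by simp
  show "measure Q A = exp (- b\<^sup>2 * s / 2) * (\<integral>\<omega>\<in>A. leg_harmonic \<mu> b m (\<omega> s) \<partial>W)"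
    if "0 \<le> s" "A \<in> sets (path_filtration s)" for s A
    using Q'(2)[OF cylindersI[OF that]] q[OF that] \<open>Q = Q'\<close> by simp
qed

end

section \<open>Identification of a density in product form\<close>

text \<open>The functions on the individual legs are glued to one function \<open>F\<close> on the spider, continuous along
  every leg, since the semigroup acts on functions of that kind.\<close>

locale spider_density =
  fixes \<mu> :: "'e::finite pmf" and W \<nu> :: "(real \<Rightarrow> 'e spider) measure"
    and F :: "'e spider \<Rightarrow> real" and h h' :: "real \<Rightarrow> real"
  assumes \<mu>: "\<And>k. 0 < pmf \<mu> k"
    and W: "brownian_spider \<mu> junction W"
    and \<nu>: "path_law \<nu>"
    and dens: "\<And>s. 0 \<le> s \<Longrightarrow> has_density_on \<nu> W (path_filtration s) (\<lambda>\<omega>. h s * F (\<omega> s))"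
    and cont: "\<And>k. continuous_on UNIV (\<lambda>y. F (spoke k y))"
    and F0: "F junction = 1"
    and h': "\<And>s. 0 \<le> s \<Longrightarrow> (h has_real_derivative h' s) (at s within {0..})"
begin

lemma law_W: "path_law W"
  using W by (rule path_law_brownian_spider)

sublocale W: prob_space W using law_W by (rule prob_space_path_law)
sublocale \<nu>: prob_space \<nu> using \<nu> by (rule prob_space_path_law)

lemmas space_W [simp] = space_path_law[OF law_W]
  and space_\<nu> [simp] = space_path_law[OF \<nu>]
  and eval_W = measurable_eval[OF law_W]
  and sets_W = path_filtration_sets_path_law[OF law_W]

lemma F_measurable [measurable]: "F \<in> borel_measurable borel"
  by (intro borel_measurable_spiderI borel_measurable_continuous_onI cont)

lemma emeasure_\<nu>:
  assumes s: "0 \<le> s" and A: "A \<in> sets (path_filtration s)"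
  shows "emeasure \<nu> A = (\<integral>\<^sup>+\<omega>. ennreal (h s * F (\<omega> s)) * indicator A \<omega> \<partial>W)"
proof -
  note subW = subalgebra_path_filtration[OF law_W s] and sub\<nu> = subalgebra_path_filtration[OF \<nu> s]
  have g [measurable]: "(\<lambda>\<omega>. h s * F (\<omega> s)) \<in> borel_measurable (path_filtration s)"
    and eq: "restr_to_subalg \<nu> (path_filtration s)
      = density (restr_to_subalg W (path_filtration s)) (\<lambda>\<omega>. ennreal (h s * F (\<omega> s)))"
    using dens[OF s] by (auto simp: has_density_on_def)
  have "emeasure \<nu> A = emeasure (restr_to_subalg \<nu> (path_filtration s)) A"
    using emeasure_restr_to_subalg[OF sub\<nu> A] by simp
  also have "\<dots> = (\<integral>\<^sup>+\<omega>. ennreal (h s * F (\<omega> s)) * indicator A \<omega> \<partial>restr_to_subalg W (path_filtration s))"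
    unfolding eq using A measurable_in_subalg[OF subW g]
    by (intro emeasure_density) (auto simp: sets_restr_to_subalg[OF subW])
  also have "\<dots> = (\<integral>\<^sup>+\<omega>. ennreal (h s * F (\<omega> s)) * indicator A \<omega> \<partial>W)"
    by (intro nn_integral_subalgebra2[OF subW] borel_measurable_times_ennreal
        measurable_compose[OF g measurable_ennreal] borel_measurable_indicator A)
  finally show ?thesis .
qed

lemma AE_density_nonneg: "0 \<le> s \<Longrightarrow> AE \<omega> in W. 0 \<le> h s * F (\<omega> s)"
  using dens[of s] subalgebra_path_filtration[OF law_W, of s]
  by (auto simp: has_density_on_def intro: AE_restr_to_subalg)

lemma total_mass: "0 \<le> s \<Longrightarrow> (\<integral>\<^sup>+\<omega>. ennreal (h s * F (\<omega> s)) \<partial>W) = 1"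
  using emeasure_\<nu>[of s paths] sets.top[of "path_filtration s"] \<nu>.emeasure_space_1
    nn_set_integral_space[of W "\<lambda>\<omega>. ennreal (h s * F (\<omega> s))"]
  by simp

lemma h_0: "h 0 = 1"
proof -
  have "(\<integral>\<^sup>+\<omega>. ennreal (h 0 * F (\<omega> 0)) \<partial>W) = (\<integral>\<^sup>+\<omega>. ennreal (h 0) \<partial>W)"
    using W by (intro nn_integral_cong_AE) (auto simp: brownian_spider_def F0 elim: eventually_mono)
  then show ?thesis
    using total_mass[of 0] W.emeasure_space_1 by simp
qed

lemma continuous_on_h: "continuous_on {0..} h"
  using h' by (auto simp: continuous_on_eq_continuous_within intro: DERIV_continuous)

lemma h_pos:
  assumes "0 \<le> s" shows "0 < h s"
proof (rule ccontr)
  assume "\<not> 0 < h s"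
  then have "h s \<le> 0" by simp
  moreover have "continuous_on {0..s} h"
    using continuous_on_h by (rule continuous_on_subset) auto
  ultimately obtain u where "0 \<le> u" "h u = 0"
    using IVT2'[of h s 0 0] h_0 assms by auto
  then show False using total_mass[of u] by simp
qed

text \<open>For \<open>s > 0\<close> the law of the spider at time \<open>s\<close> has a strictly positive density on every leg.\<close>

lemma AE_legs:
  assumes "0 < s" and AE: "AE \<omega> in W. P (\<omega> s)" and [measurable]: "{a. P a} \<in> sets borel"
  shows "AE y in lborel. 0 < y \<longrightarrow> (\<forall>k. P (spoke k y))"
proof -
  have [measurable]: "Measurable.pred borel P"
    using \<open>{a. P a} \<in> sets borel\<close> by (simp add: pred_def)
  let ?N = "\<lambda>a. indicator {a. \<not> P a} a :: ennreal"
  let ?S = "\<lambda>y. \<Sum>k\<in>UNIV. ennreal (indicator {0<..} y * spider_kernel \<mu> s junction k y) * ?N (spoke k y)"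
  have "0 = (\<integral>\<^sup>+\<omega>. ?N (\<omega> s) \<partial>W)"
    using AE by (subst nn_integral_cong_AE[where v = "\<lambda>_. 0"]) (auto elim: eventually_mono)
  also have "\<dots> = nn_semigroup \<mu> s ?N junction"
    by (rule brownian_spider_law[OF W \<open>0 < s\<close>]) measurable
  finally have zero: "(\<integral>\<^sup>+y. ?S y \<partial>lborel) = 0"
    unfolding nn_semigroup_def by (rule sym)
  have "?S \<in> borel_measurable lborel" by measurable
  from nn_integral_0_iff_AE[OF this] zero have "AE y in lborel. ?S y = 0" by (rule iffD1)
  then show ?thesis
  proof eventually_elim
    case (elim y)
    show ?case
    proof (intro impI allI)
      fix k assume "0 < y"
      moreover have "0 < spider_kernel \<mu> s junction k y"
        using \<mu>[of k] \<open>0 < s\<close> normal_density_pos[of "sqrt s" 0 y]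
        by (simp add: spider_kernel_def Let_def normal_density_def)
      moreover have "ennreal (indicator {0<..} y * spider_kernel \<mu> s junction k y) * ?N (spoke k y) = 0"
        using elim by (subst (asm) sum_eq_0_iff) auto
      ultimately show "P (spoke k y)"
        by (auto simp: indicator_def split: if_splits)
    qed
  qed
qed

lemma F_nonneg: "0 \<le> F a"
proof -
  have "AE \<omega> in W. 0 \<le> F (\<omega> 1)"
    using AE_density_nonneg[of 1] h_pos[of 1] by (auto simp: zero_le_mult_iff elim!: eventually_mono)
  then have "AE y in lborel. 0 < y \<longrightarrow> (\<forall>k. 0 \<le> F (spoke k y))"
    by (intro AE_legs[of 1 "\<lambda>a. 0 \<le> F a"]) auto
  then have "AE y in lborel. 0 < y \<longrightarrow> y \<in> {y. 0 \<le> F (spoke (the (leg a)) y)}"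
    by eventually_elim auto
  then have "radius a \<in> {y. 0 \<le> F (spoke (the (leg a)) y)}"
    by (rule AE_lborel_closedD) (auto intro!: closed_Collect_le continuous_intros cont radius_nonneg)
  then show ?thesis by simp
qed

text \<open>The total mass of \<open>\<nu>\<close>, expressed through the law of the spider started at the junction.\<close>

lemma nn_semigroup_F_junction:
  assumes "0 < t"
  shows "nn_semigroup \<mu> t (\<lambda>a. ennreal (F a)) junction = ennreal (1 / h t)"
proof -
  have "1 = (\<integral>\<^sup>+\<omega>. ennreal (h t) * ennreal (F (\<omega> t)) \<partial>W)"
    using total_mass[of t] assms h_pos[of t] by (simp add: ennreal_mult' F_nonneg)
  also have "\<dots> = ennreal (h t) * nn_semigroup \<mu> t (\<lambda>a. ennreal (F a)) junction"
    using assms measurable_compose[OF eval_W F_measurable, of t] brownian_spider_law[OF W \<open>0 < t\<close>, of "\<lambda>a. ennreal (F a)"]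
    by (subst nn_integral_cmult) auto
  finally have "ennreal (1 / h t) * 1 = ennreal (1 / h t) * ennreal (h t) * nn_semigroup \<mu> t (\<lambda>a. ennreal (F a)) junction"
    by (simp add: mult.assoc)
  also have "ennreal (1 / h t) * ennreal (h t) = 1"
    using h_pos[of t] assms by (simp flip: ennreal_mult')
  finally show ?thesis by simp
qed

text \<open>The measure \<open>\<nu>\<close> of an event at time \<open>s\<close> can be computed with the density at time \<open>s\<close> or, by the
  Markov property, with the density at time \<open>s + t\<close>; densities with respect to the law of the spider
  at time \<open>s\<close> are unique almost everywhere.\<close>

lemma AE_nn_semigroup_F:
  assumes "0 < s" "0 < t"
  shows "AE y in lborel. 0 < y \<longrightarrow>
    (\<forall>k. nn_semigroup \<mu> t (\<lambda>a. ennreal (F a)) (spoke k y) = ennreal (h s / h (s + t) * F (spoke k y)))"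
proof (rule AE_legs[OF \<open>0 < s\<close>])
  let ?P = "nn_semigroup \<mu> t (\<lambda>a. ennreal (F a))"
  let ?D = "distr W borel (\<lambda>\<omega>. \<omega> s)"
  have [measurable]: "(\<lambda>\<omega>. \<omega> s) \<in> W \<rightarrow>\<^sub>M borel" "(\<lambda>\<omega>. \<omega> (s + t)) \<in> W \<rightarrow>\<^sub>M borel"
    using eval_W[of s] eval_W[of "s + t"] assms by simp_all
  have P [measurable]: "?P \<in> borel_measurable borel" by measurable
  have h: "0 < h s" "0 < h (s + t)" using h_pos assms by simp_all
  have ratio: "ennreal (h s / h (s + t)) = ennreal (1 / h (s + t)) * ennreal (h s)"
    using h by (simp flip: ennreal_mult')
  interpret D: prob_space ?D by (rule W.prob_space_distr) measurable
  have "AE a in ?D. ennreal (h s / h (s + t)) * ennreal (F a) = ?P a"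
  proof (rule D.density_unique_finite_measure)
    fix B :: "'e spider set" assume "B \<in> sets ?D"
    then have [measurable]: "B \<in> sets borel" by simp
    let ?A = "(\<lambda>\<omega>. \<omega> s) -` B \<inter> paths"
    have A: "?A \<in> sets (path_filtration s)"
      using measurable_sets[OF measurable_eval_filtration[of s s], of B] assms by simp
    then have A': "?A \<in> sets (path_filtration (s + t))"
      using sets_path_filtration_mono[of s "s + t"] assms by auto
    have ind: "indicator B (\<omega> s) = (indicator ?A \<omega> :: ennreal)" if "\<omega> \<in> space W" for \<omega>
      using that by (auto simp: indicator_def)
    then have swap: "(\<integral>\<^sup>+\<omega>. G (\<omega> s) * indicator B (\<omega> s) \<partial>W) = (\<integral>\<^sup>+\<omega>. G (\<omega> s) * indicator ?A \<omega> \<partial>W)"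
      for G :: "'e spider \<Rightarrow> ennreal"
      by (intro nn_integral_cong) simp
    have [measurable]: "?A \<in> sets W" using sets_W[OF _ A] assms by simp
    have "ennreal (h s) * (\<integral>\<^sup>+\<omega>. ennreal (F (\<omega> s)) * indicator B (\<omega> s) \<partial>W) = emeasure \<nu> ?A"
      unfolding swap[of "\<lambda>a. ennreal (F a)"] using emeasure_\<nu>[OF _ A] assms h
      by (simp add: ennreal_mult' F_nonneg mult.assoc nn_integral_cmult)
    also have "\<dots> = ennreal (h (s + t)) * (\<integral>\<^sup>+\<omega>. ennreal (F (\<omega> (s + t))) * indicator ?A \<omega> \<partial>W)"
      using emeasure_\<nu>[OF _ A'] assms h
      by (simp add: ennreal_mult' F_nonneg mult.assoc nn_integral_cmult)
    also have "\<dots> = ennreal (h (s + t)) * (\<integral>\<^sup>+\<omega>. ?P (\<omega> s) * indicator B (\<omega> s) \<partial>W)"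
      unfolding swap[of ?P] using brownian_spider_Markov[OF W _ \<open>0 < t\<close> A, of "\<lambda>a. ennreal (F a)"] assms
      by simp
    finally have "ennreal (1 / h (s + t)) * (ennreal (h s) * (\<integral>\<^sup>+\<omega>. ennreal (F (\<omega> s)) * indicator B (\<omega> s) \<partial>W))
        = ennreal (1 / h (s + t)) * ennreal (h (s + t)) * (\<integral>\<^sup>+\<omega>. ?P (\<omega> s) * indicator B (\<omega> s) \<partial>W)"
      by (simp add: mult.assoc)
    also have "ennreal (1 / h (s + t)) * ennreal (h (s + t)) = 1"
      using h by (simp flip: ennreal_mult')
    finally show "(\<integral>\<^sup>+a. ennreal (h s / h (s + t)) * ennreal (F a) * indicator B a \<partial>?D) = (\<integral>\<^sup>+a. ?P a * indicator B a \<partial>?D)"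
      by (simp add: nn_integral_distr nn_integral_cmult mult.assoc ratio)
  qed auto
  then show "AE \<omega> in W. ?P (\<omega> s) = ennreal (h s / h (s + t) * F (\<omega> s))" (is ?thesis)
  proof (subst (asm) AE_distr_iff)
    have "ennreal (h s / h (s + t) * F a) = ennreal (h s / h (s + t)) * ennreal (F a)" for a
      using F_nonneg by (intro ennreal_mult'') auto
    then show "AE \<omega> in W. ennreal (h s / h (s + t)) * ennreal (F (\<omega> s)) = ?P (\<omega> s) \<Longrightarrow> ?thesis"
      by (auto elim!: eventually_mono)
  qed measurable
  show "{a. ?P a = ennreal (h s / h (s + t) * F a)} \<in> sets borel"
    by measurable
qed

text \<open>The eigenvalue relation shows that \<open>h s / h (s + t)\<close> is the same for all \<open>s > 0\<close>, as \<open>F\<close> does not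
  vanish near the junction; letting \<open>s\<close> tend to \<open>0\<close> identifies it with \<open>1 / h t\<close>.\<close>

lemma h_mult:
  assumes "0 \<le> s" "0 \<le> t"
  shows "h (s + t) = h s * h t"
proof (cases "s = 0 \<or> t = 0")
  case False
  with assms have st: "0 < s" "0 < t" by auto
  have ratio: "h u / h (u + t) = h s / h (s + t)" if "0 < u" for u
  proof (rule ccontr)
    assume ne: "h u / h (u + t) \<noteq> h s / h (s + t)"
    fix k :: 'e
    have "AE y in lborel. 0 < y \<longrightarrow> y \<in> {y. F (spoke k y) = 0}"
      using AE_nn_semigroup_F[OF that st(2)] AE_nn_semigroup_F[OF st]
    proof eventually_elim
      case (elim y)
      show ?case
      proof
        assume "0 < y"
        with elim have "ennreal (h u / h (u + t) * F (spoke k y)) = ennreal (h s / h (s + t) * F (spoke k y))"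
          by metis
        moreover have "0 < h u" "0 < h (u + t)" "0 < h s" "0 < h (s + t)"
          using that st by (auto intro: h_pos)
        ultimately have "h u / h (u + t) * F (spoke k y) = h s / h (s + t) * F (spoke k y)"
          by (subst (asm) ennreal_inj) (intro mult_nonneg_nonneg divide_nonneg_nonneg F_nonneg less_imp_le; assumption)+
        then show "y \<in> {y. F (spoke k y) = 0}"
          unfolding mult_cancel_right using ne by simp
      qed
    qed
    then have "0 \<in> {y. F (spoke k y) = 0}"
      by (rule AE_lborel_closedD) (auto intro!: closed_Collect_eq continuous_intros cont)
    then show False by (simp add: F0)
  qed
  have "continuous_on {0..} (\<lambda>u. h u / h (u + t))"
  proof (intro continuous_on_divide continuous_on_h continuous_on_compose2[OF continuous_on_h] continuous_intros ballI)
    show "h (u + t) \<noteq> 0" if "u \<in> {0..}" for u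
      using h_pos[of "u + t"] that st by simp
  qed (use st in auto)
  then have "((\<lambda>u. h u / h (u + t)) \<longlongrightarrow> h 0 / h (0 + t)) (at 0 within {0..})"
    unfolding continuous_on_def by (rule bspec) simp
  then have "((\<lambda>u. h u / h (u + t)) \<longlongrightarrow> h 0 / h (0 + t)) (at_right 0)"
    by (simp add: at_within_Ici_at_right)
  moreover have "((\<lambda>u. h u / h (u + t)) \<longlongrightarrow> h s / h (s + t)) (at_right 0)"
    using ratio eventually_at_right_less[of 0]
    by (intro tendsto_eventually) (auto elim: eventually_mono)
  ultimately have "h 0 / h (0 + t) = h s / h (s + t)"
    by (intro tendsto_unique[OF trivial_limit_at_right_real])
  then show ?thesis
    using h_0 h_pos[of t] h_pos[of "s + t"] st by (simp add: field_simps)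
qed (auto simp: h_0)

definition rate :: real where "rate = - h' 0"

lemma h_eq: "0 \<le> s \<Longrightarrow> h s = exp (- rate * s)"
  using multiplicative_imp_exp[of h h' s, OF h_mult h_0 h'] by (simp add: rate_def)

text \<open>Since \<open>sqrt t * p\<^sub>t(y)\<close> increases with \<open>t\<close>, one has \<open>p\<^sub>T \<le> 2 * p\<^sub>4\<^sub>T\<close>, hence
  \<open>exp (rate * T) \<le> 2 * exp (4 * rate * T)\<close>.  For a negative rate and \<open>T = - 1 / rate\<close> this would
  say \<open>exp 3 \<le> 2\<close>.\<close>

lemma rate_nonneg: "0 \<le> rate"
proof (rule ccontr)
  assume "\<not> 0 \<le> rate"
  define T where "T = - 1 / rate"
  have T: "0 < T" "rate * T = - 1"
    using \<open>\<not> 0 \<le> rate\<close> by (auto simp: T_def field_simps)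
  have density_le: "normal_density 0 (sqrt T) y \<le> 2 * normal_density 0 (sqrt (4 * T)) y" for y
  proof -
    have "y\<^sup>2 / (8 * T) \<le> y\<^sup>2 / (2 * T)"
      using T by (intro divide_left_mono) auto
    moreover have "sqrt (pi * (8 * T)) = 2 * sqrt (pi * (2 * T))"
      using real_sqrt_mult[of 4 "pi * (2 * T)"] by (simp add: mult_ac)
    ultimately show ?thesis
      using T by (simp add: normal_density_def mult_ac divide_right_mono)
  qed
  have kernel_le: "ennreal (indicator {0<..} y * spider_kernel \<mu> T junction k y)
      \<le> 2 * ennreal (indicator {0<..} y * spider_kernel \<mu> (4 * T) junction k y)" for y k
  proof -
    have "spider_kernel \<mu> t junction k y = 2 * pmf \<mu> k * normal_density 0 (sqrt t) y" for t
      by (simp add: spider_kernel_def Let_def normal_density_def)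
    then have "indicator {0<..} y * spider_kernel \<mu> T junction k y
        \<le> 2 * (indicator {0<..} y * spider_kernel \<mu> (4 * T) junction k y)"
      using mult_left_mono[OF density_le[of y], of "2 * pmf \<mu> k"]
      by (auto simp: indicator_def mult_ac)
    then show ?thesis
      using ennreal_leI by (fastforce simp: ennreal_mult')
  qed
  have "nn_semigroup \<mu> T (\<lambda>a. ennreal (F a)) junction \<le> 2 * nn_semigroup \<mu> (4 * T) (\<lambda>a. ennreal (F a)) junction"
    unfolding nn_semigroup_def
    by (subst nn_integral_cmult[symmetric], measurable)
       (auto simp: sum_distrib_left mult.assoc[symmetric] intro!: nn_integral_mono sum_mono mult_right_mono kernel_le)
  moreover have "2 * ennreal (1 / h (4 * T)) = ennreal (2 * (1 / h (4 * T)))"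
    by (subst ennreal_mult') simp_all
  ultimately have "ennreal (1 / h T) \<le> ennreal (2 * (1 / h (4 * T)))"
    using nn_semigroup_F_junction[of T] nn_semigroup_F_junction[of "4 * T"] T by simp
  then have "1 / h T \<le> 2 * (1 / h (4 * T))"
    using T h_pos[of "4 * T"] by (subst (asm) ennreal_le_iff) auto
  moreover have "h T = exp 1" "h (4 * T) = exp 1 * exp 3"
    using T h_eq[of T] h_eq[of "4 * T"] by (simp_all add: mult.left_commute flip: exp_add)
  ultimately have "exp (3 :: real) \<le> 2"
    by (simp add: field_simps)
  then show False
    using exp_ge_add_one_self[of "3 :: real"] by simp
qed

definition growth :: real where "growth = sqrt (2 * rate)"

lemma growth_nonneg: "0 \<le> growth" and rate_eq: "rate = growth\<^sup>2 / 2"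
  using rate_nonneg by (simp_all add: growth_def)

lemma h_growth: "0 \<le> s \<Longrightarrow> h s = exp (- (growth\<^sup>2 * s / 2))"
  by (simp add: h_eq rate_eq)

lemma inverse_h: "0 \<le> s \<Longrightarrow> 1 / h s = exp (growth\<^sup>2 * s / 2)"
  by (simp add: h_growth exp_minus inverse_eq_divide)

text \<open>At the junction only the mean over the legs enters the semigroup.  Its even extension is a Gaussian
  eigenfunction at \<open>0\<close>, where the functional equation reads \<open>2 * g z = 2 * cosh (growth * z)\<close>.\<close>

lemma mean_F:
  assumes "0 \<le> z"
  shows "(\<Sum>k\<in>UNIV. pmf \<mu> k * F (spoke k z)) = cosh (growth * z)"
proof -
  define g where "g y = (\<Sum>k\<in>UNIV. pmf \<mu> k * F (spoke k \<bar>y\<bar>))" for y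
  have g0: "g 0 = 1" by (simp add: g_def F0 sum_pmf_eq_1)
  have cont_g: "continuous_on UNIV g"
    unfolding g_def by (intro continuous_intros continuous_on_compose2[OF cont]) auto
  note [measurable] = borel_measurable_continuous_onI[OF cont_g]
  have g_nonneg: "0 \<le> g y" for y
    unfolding g_def by (intro sum_nonneg mult_nonneg_nonneg F_nonneg) auto
  have eigen: "has_bochner_integral lborel (\<lambda>y. normal_density 0 (sqrt t) (0 - y) * g y) (exp (growth\<^sup>2 * t / 2) * g 0)"
    if "0 < t" for t
  proof (rule has_bochner_integral_even)
    have sym: "normal_density 0 (sqrt t) (- y) = normal_density 0 (sqrt t) y" for y
      by (simp add: normal_density_def)
    have "nn_semigroup \<mu> t (\<lambda>a. ennreal (F a)) (spoke undefined 0)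
        = (\<integral>\<^sup>+y. ennreal (indicator {0<..} y * (2 * (normal_density 0 (sqrt t) (0 - y) * g y))) \<partial>lborel)"
      unfolding nn_semigroup_eq_integral[OF F_nonneg] spider_kernel_sum[OF order_refl]
      by (intro nn_integral_cong) (auto simp: indicator_def g_def sym algebra_simps)
    then show "has_bochner_integral lborel (\<lambda>y. indicator {0<..} y * (2 * (normal_density 0 (sqrt t) (0 - y) * g y))) (exp (growth\<^sup>2 * t / 2) * g 0)"
      using nn_semigroup_F_junction[OF that] that
      by (intro has_bochner_integral_nn_integral) (auto simp: g0 inverse_h g_nonneg)
  qed (auto simp: g_def normal_density_def)
  have "g (0 + z) + g (0 - z) = 2 * g 0 * cosh (growth * z)"
    by (intro gaussian_eigenfunction_dAlembert cont_g eigen) simp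
  then show ?thesis using assms g0 by (simp add: g_def)
qed

text \<open>A nonnegative function is controlled on each leg by its mean; this gives the integrability against
  Gaussian densities.\<close>

lemma F_le_cosh: "0 \<le> z \<Longrightarrow> F (spoke k z) \<le> cosh (growth * z) / pmf \<mu> k"
proof -
  assume z: "0 \<le> z"
  have "pmf \<mu> k * F (spoke k z) \<le> (\<Sum>k\<in>UNIV. pmf \<mu> k * F (spoke k z))"
    by (intro member_le_sum) (auto intro: mult_nonneg_nonneg F_nonneg)
  then show ?thesis
    using \<mu>[of k] mean_F[OF z] by (simp add: pos_le_divide_eq mult.commute)
qed

lemma unfold_at_F_neg: "y \<le> 0 \<Longrightarrow> unfold_at \<mu> F j y = 2 * cosh (growth * y) - F (spoke j (- y))"
  using mean_F[of "- y"] by (auto simp: unfold_at_def F0)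

lemma continuous_on_unfold_at_F: "continuous_on UNIV (unfold_at \<mu> F j)"
proof -
  have eq: "unfold_at \<mu> F j y = F (spoke j y) + (2 * cosh (growth * min y 0) - F (spoke j (- y)) - 1)" for y
    using unfold_at_F_neg[of y j] by (cases "0 \<le> y") (auto simp: unfold_at_def F0 min_def)
  show ?thesis
    unfolding eq[abs_def]
    by (intro continuous_intros continuous_on_compose2[OF cont]) auto
qed

lemma unfold_at_F_bound: "\<bar>unfold_at \<mu> F j y\<bar> \<le> (2 + 1 / pmf \<mu> j) * cosh (growth * y)"
proof -
  have "0 \<le> cosh (growth * y)" by simp
  moreover have "(2 + 1 / pmf \<mu> j) * cosh (growth * y) = 2 * cosh (growth * y) + cosh (growth * y) / pmf \<mu> j"
    by (simp add: distrib_right)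
  moreover have "0 \<le> F (spoke j \<bar>y\<bar>)" "F (spoke j \<bar>y\<bar>) \<le> cosh (growth * y) / pmf \<mu> j"
    using F_nonneg F_le_cosh[of "\<bar>y\<bar>" j] by (auto simp: abs_if split: if_splits)
  ultimately show ?thesis
    using unfold_at_F_neg[of y j]
    by (cases "0 \<le> y") (simp_all add: unfold_at_def abs_le_iff del: cosh_real_nonneg)
qed

lemma integrable_unfold_at_F:
  assumes "0 < t"
  shows "integrable lborel (\<lambda>y. normal_density 0 (sqrt t) (x - y) * unfold_at \<mu> F j y)"
proof (rule Bochner_Integration.integrable_bound)
  note [measurable] = borel_measurable_continuous_onI[OF continuous_on_unfold_at_F]
  show "(\<lambda>y. normal_density 0 (sqrt t) (x - y) * unfold_at \<mu> F j y) \<in> borel_measurable lborel"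
    by measurable
  have "integrable lborel (\<lambda>y. normal_density 0 (sqrt t) (x - y) * cosh (growth * y))"
    using has_bochner_integral_gaussian_hyperbolic[OF assms, of x growth 0] by (simp add: has_bochner_integral_iff)
  then show "integrable lborel (\<lambda>y. (2 + 1 / pmf \<mu> j) * (normal_density 0 (sqrt t) (x - y) * cosh (growth * y)))"
    by (intro integrable_mult_right)
  show "AE y in lborel. norm (normal_density 0 (sqrt t) (x - y) * unfold_at \<mu> F j y)
      \<le> norm ((2 + 1 / pmf \<mu> j) * (normal_density 0 (sqrt t) (x - y) * cosh (growth * y)))"
  proof (rule AE_I2)
    fix y
    let ?p = "normal_density 0 (sqrt t) (x - y)"
    have "norm (?p * unfold_at \<mu> F j y) = ?p * \<bar>unfold_at \<mu> F j y\<bar>"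
      by (simp add: abs_mult)
    also have "\<dots> \<le> ?p * ((2 + 1 / pmf \<mu> j) * cosh (growth * y))"
      by (intro mult_left_mono unfold_at_F_bound) simp
    also have "\<dots> \<le> norm ((2 + 1 / pmf \<mu> j) * (?p * cosh (growth * y)))"
      unfolding real_norm_def mult.left_commute[of ?p] by (rule abs_ge_self)
    finally show "norm (?p * unfold_at \<mu> F j y) \<le> norm ((2 + 1 / pmf \<mu> j) * (?p * cosh (growth * y)))" .
  qed
qed

text \<open>For almost every \<open>x > 0\<close> the eigenvalue relation holds simultaneously for the countably many
  variances that the functional equation needs; continuity extends the equation to all \<open>x \<ge> 0\<close>.\<close>

lemma unfold_at_F_dAlembert:
  assumes "0 \<le> x"
  shows "unfold_at \<mu> F j (x + z) + unfold_at \<mu> F j (x - z) = 2 * unfold_at \<mu> F j x * cosh (growth * z)"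
proof -
  let ?v = "unfold_at \<mu> F j"
  let ?t = "\<lambda>n. 1 / (2 * real n)"
  have "AE x in lborel. \<forall>n. 1 \<le> n \<longrightarrow> 0 < x \<longrightarrow>
      nn_semigroup \<mu> (?t n) (\<lambda>a. ennreal (F a)) (spoke j x) = ennreal (exp (growth\<^sup>2 * ?t n / 2) * F (spoke j x))"
    unfolding AE_all_countable
  proof
    fix n
    show "AE x in lborel. 1 \<le> n \<longrightarrow> 0 < x \<longrightarrow>
      nn_semigroup \<mu> (?t n) (\<lambda>a. ennreal (F a)) (spoke j x) = ennreal (exp (growth\<^sup>2 * ?t n / 2) * F (spoke j x))"
    proof (cases "1 \<le> n")
      case True
      then have t: "0 < ?t n" by simp
      have "h 1 / h (1 + ?t n) = exp (growth\<^sup>2 * ?t n / 2)"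
        using h_mult[of 1 "?t n"] h_pos[of 1] inverse_h[of "?t n"] t by simp
      then show ?thesis
        using AE_nn_semigroup_F[OF zero_less_one t] by (auto elim: eventually_mono)
    qed simp
  qed
  then have "AE x in lborel. 0 < x \<longrightarrow> x \<in> {x. ?v (x + z) + ?v (x - z) = 2 * ?v x * cosh (growth * z)}"
  proof eventually_elim
    case (elim x)
    show ?case
    proof (intro impI CollectI gaussian_eigenfunction_dAlembert continuous_on_unfold_at_F)
      fix n :: nat assume "0 < x" and n: "1 \<le> n"
      then have t: "0 < ?t n" by simp
      let ?I = "\<integral>y. normal_density 0 (sqrt (?t n)) (x - y) * ?v y \<partial>lborel"
      have I: "has_bochner_integral lborel (\<lambda>y. normal_density 0 (sqrt (?t n)) (x - y) * ?v y) ?I"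
        using integrable_unfold_at_F[OF t] by (rule has_bochner_integral_integrable)
      have "ennreal ?I = ennreal (exp (growth\<^sup>2 * ?t n / 2) * F (spoke j x))"
        using nn_semigroup_unfold_at(2)[OF F_nonneg _ I] elim \<open>0 < x\<close> n by auto
      then have "?I = exp (growth\<^sup>2 * ?t n / 2) * F (spoke j x)"
        using nn_semigroup_unfold_at(1)[OF F_nonneg _ I] \<open>0 < x\<close> F_nonneg by simp
      with I show "has_bochner_integral lborel (\<lambda>y. normal_density 0 (sqrt (?t n)) (x - y) * ?v y) (exp (growth\<^sup>2 * ?t n / 2) * ?v x)"
        using \<open>0 < x\<close> by (simp add: unfold_at_def)
    qed
  qed
  then have "x \<in> {x. ?v (x + z) + ?v (x - z) = 2 * ?v x * cosh (growth * z)}"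
  proof (rule AE_lborel_closedD[OF _ _ assms])
    show "closed {x. ?v (x + z) + ?v (x - z) = 2 * ?v x * cosh (growth * z)}"
      by (intro closed_Collect_eq continuous_intros continuous_on_compose2[OF continuous_on_unfold_at_F]) auto
  qed
  then show ?thesis by simp
qed

lemma unfold_at_F_0: "unfold_at \<mu> F j 0 = 1"
  by (simp add: unfold_at_def F0)

text \<open>For vanishing growth \<open>F\<close> is bounded, hence constant, and \<open>\<nu>\<close> agrees with \<open>W\<close> on the cylinders.\<close>

lemma growth_pos:
  assumes "\<nu> \<noteq> W" shows "0 < growth"
proof (rule ccontr)
  assume "\<not> 0 < growth"
  then have g0: "growth = 0" using growth_nonneg by simp
  have "unfold_at \<mu> F (the (leg a)) (radius a) = 1" for a
    using unfold_at_F_bound[of "the (leg a)"] g0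
    by (intro dAlembert_bounded_const[OF unfold_at_F_dAlembert unfold_at_F_0 _ _ radius_nonneg]) auto
  moreover have "unfold_at \<mu> F (the (leg a)) (radius a) = F a" for a
    using radius_nonneg[of a] by (simp add: unfold_at_def)
  ultimately have F1: "F a = 1" for a by simp
  then have "emeasure \<nu> A = emeasure W A" if "0 \<le> s" "A \<in> sets (path_filtration s)" for A s
    using emeasure_\<nu>[OF that] sets_W[OF that] h_growth[OF \<open>0 \<le> s\<close>] g0 by (simp add: F1)
  then have "\<nu> = W"
    by (intro path_law_eqI \<nu> law_W) (auto simp: cylinders_def measure_def)
  with assms show False by simp
qed

text \<open>On leg \<open>j\<close>, \<open>F = cosh + c j * sinh\<close>.  Nonnegativity at infinity means \<open>c j \<ge> - 1\<close>, and the mean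
  over the legs being \<open>cosh\<close> means \<open>\<Sum>j. \<mu>\<^sub>j * c j = 0\<close>; so \<open>\<mu>\<^sub>j * (1 + c j)\<close> are the weights of a
  convex combination.\<close>

lemma F_decomposition:
  assumes "0 < growth"
  obtains w where "\<And>m. 0 \<le> w m" "(\<Sum>m\<in>UNIV. w m) = 1"
    "\<And>a. F a = (\<Sum>m\<in>UNIV. w m * leg_harmonic \<mu> growth m a)"
proof -
  have "\<exists>c. \<forall>x. unfold_at \<mu> F j x = cosh (growth * x) + c * sinh (growth * x)" for j
  proof -
    obtain c where "\<And>x. unfold_at \<mu> F j x = cosh (growth * x) + c * sinh (growth * x)"
      using dAlembert_solution[of "unfold_at \<mu> F j" growth, OF unfold_at_F_dAlembert[where j = j] unfold_at_F_0 assms]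
      by blast
    then show ?thesis by blast
  qed
  then obtain c where c: "\<And>j x. unfold_at \<mu> F j x = cosh (growth * x) + c j * sinh (growth * x)"
    by metis
  have F: "F (spoke j x) = cosh (growth * x) + c j * sinh (growth * x)" if "0 \<le> x" for j x
    using c[of j x] that by (simp add: unfold_at_def)
  \<comment> \<open>Up to a positive factor, \<open>F\<close> on leg \<open>j\<close> is \<open>1 + c j + (1 - c j) * exp (- 2 * growth * x)\<close>.\<close>
  have c_ge: "0 \<le> 1 + c j" for j
  proof (rule tendsto_lowerbound)
    have lim: "((\<lambda>x. exp (- (2 * growth * x))) \<longlongrightarrow> 0) at_top"
    proof -
      have "filterlim (\<lambda>x. 2 * growth * x) at_top at_top"
        using assms by (intro filterlim_tendsto_pos_mult_at_top[OF tendsto_const _ filterlim_ident]) simp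
      then show ?thesis
        by (intro filterlim_compose[OF exp_at_bot] filterlim_compose[OF filterlim_uminus_at_bot_at_top])
    qed
    show "((\<lambda>x. 1 + c j + (1 - c j) * exp (- (2 * growth * x))) \<longlongrightarrow> 1 + c j) at_top"
      using tendsto_add[OF tendsto_const tendsto_mult[OF tendsto_const lim], of "1 + c j" "1 - c j"] by simp
    show "\<forall>\<^sub>F x in at_top. 0 \<le> 1 + c j + (1 - c j) * exp (- (2 * growth * x))"
      using eventually_ge_at_top[of 0]
    proof eventually_elim
      case (elim x)
      have "1 + c j + (1 - c j) * exp (- (2 * growth * x)) = 2 * exp (- (growth * x)) * F (spoke j x)"
        unfolding F[OF elim] cosh_def sinh_def
        by (simp add: field_simps flip: exp_add)
      then show ?case using F_nonneg by simp
    qed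
  qed simp
  have "cosh growth = cosh growth * (\<Sum>k\<in>UNIV. pmf \<mu> k) + sinh growth * (\<Sum>k\<in>UNIV. pmf \<mu> k * c k)"
    using mean_F[of 1] by (simp add: F distrib_left sum.distrib sum_distrib_left mult_ac)
  then have c_mean: "(\<Sum>k\<in>UNIV. pmf \<mu> k * c k) = 0"
    using assms by (simp add: sum_pmf_eq_1)
  define w where "w k = pmf \<mu> k * (1 + c k)" for k
  have sum_w: "(\<Sum>m\<in>UNIV. w m) = 1"
    using c_mean by (simp add: w_def distrib_left sum.distrib sum_pmf_eq_1)
  show thesis
  proof (rule that)
    show "0 \<le> w m" for m using c_ge by (simp add: w_def)
    show "(\<Sum>m\<in>UNIV. w m) = 1" by (rule sum_w)
    show "F a = (\<Sum>m\<in>UNIV. w m * leg_harmonic \<mu> growth m a)" for a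
    proof -
      let ?j = "the (leg a)" and ?x = "radius a"
      have "leg_harmonic \<mu> growth m a = exp (- growth * ?x) + (if ?j = m then sinh (growth * ?x) / pmf \<mu> m else 0)" for m
        using leg_harmonic_spoke[OF radius_nonneg, of \<mu> growth m ?j a] by simp
      then have "w m * leg_harmonic \<mu> growth m a
          = exp (- growth * ?x) * w m + (if ?j = m then (1 + c m) * sinh (growth * ?x) else 0)" for m
        using \<mu>[of m] by (simp add: w_def field_simps)
      then have "(\<Sum>m\<in>UNIV. w m * leg_harmonic \<mu> growth m a) = exp (- growth * ?x) + (1 + c ?j) * sinh (growth * ?x)"
        by (simp add: sum.distrib sum_w flip: sum_distrib_left)
      also have "\<dots> = F (spoke ?j ?x)"
        unfolding F[OF radius_nonneg] using cosh_minus_sinh[of "growth * ?x"]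
        by (simp add: algebra_simps)
      finally show ?thesis by simp
    qed
  qed
qed

lemma measure_\<nu>:
  assumes "0 < growth" and w: "\<And>m. 0 \<le> w m" "\<And>a. F a = (\<Sum>m\<in>UNIV. w m * leg_harmonic \<mu> growth m a)"
    and s: "0 \<le> s" and A: "A \<in> sets (path_filtration s)"
  shows "measure \<nu> A = (\<Sum>m\<in>UNIV. w m * (exp (- growth\<^sup>2 * s / 2) * (\<integral>\<omega>\<in>A. leg_harmonic \<mu> growth m (\<omega> s) \<partial>W)))"
proof -
  have int: "set_integrable W A (\<lambda>\<omega>. leg_harmonic \<mu> growth m (\<omega> s))" for m
    using has_bochner_integral_leg_harmonic[OF W \<mu> assms(1) s, of m] sets_W[OF s A]
    by (intro set_integrable_if_integrable) (auto simp: has_bochner_integral_iff)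
  have intF: "integrable W (\<lambda>\<omega>. h s * F (\<omega> s))"
    using has_bochner_integral_leg_harmonic[OF W \<mu> assms(1) s] unfolding w(2)
    by (intro integrable_mult_right Bochner_Integration.integrable_sum)
       (auto simp: has_bochner_integral_iff)
  have nonneg: "0 \<le> h s * F a" for a
    using h_pos[OF s] F_nonneg[of a] by simp
  have "ennreal (measure \<nu> A) = (\<integral>\<^sup>+\<omega>. ennreal (h s * F (\<omega> s)) * indicator A \<omega> \<partial>W)"
    using emeasure_\<nu>[OF s A] by (simp add: \<nu>.emeasure_eq_measure)
  also have "\<dots> = ennreal (\<integral>\<omega>\<in>A. h s * F (\<omega> s) \<partial>W)"
    by (rule nn_set_integral_eq_set_integral[OF intF AE_I2 sets_W[OF s A]]) (simp add: nonneg)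
  finally have "ennreal (measure \<nu> A) = ennreal (\<integral>\<omega>\<in>A. h s * F (\<omega> s) \<partial>W)" .
  moreover have "0 \<le> (\<integral>\<omega>\<in>A. h s * F (\<omega> s) \<partial>W)"
    unfolding set_lebesgue_integral_def
    by (intro Bochner_Integration.integral_nonneg scaleR_nonneg_nonneg nonneg) simp
  ultimately have "measure \<nu> A = (\<integral>\<omega>\<in>A. h s * F (\<omega> s) \<partial>W)"
    by simp
  also have "\<dots> = (\<integral>\<omega>. (\<Sum>m\<in>UNIV. h s * w m * (indicator A \<omega> *\<^sub>R leg_harmonic \<mu> growth m (\<omega> s))) \<partial>W)"
    unfolding w(2) set_lebesgue_integral_def
    by (intro Bochner_Integration.integral_cong) (auto simp: sum_distrib_left mult_ac)
  also have "\<dots> = (\<Sum>m\<in>UNIV. h s * w m * (\<integral>\<omega>\<in>A. leg_harmonic \<mu> growth m (\<omega> s) \<partial>W))"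
    using int unfolding set_lebesgue_integral_def set_integrable_def
    by (subst Bochner_Integration.integral_sum) (simp_all only: integrable_mult_right integral_mult_right_zero)
  finally show ?thesis
    by (simp add: h_growth[OF s] mult_ac)
qed

end

text \<open>The components of weight zero may be arbitrary measures, which is why only the others are assumed
  to be path laws.\<close>

lemma path_law_mixture:
  fixes c :: "'i::finite \<Rightarrow> real"
  assumes \<nu>: "path_law \<nu>" and Q: "\<And>i. c i \<noteq> 0 \<Longrightarrow> path_law (Q i)" and one: "(\<Sum>i\<in>UNIV. c i) = 1"
    and eq: "\<And>A. A \<in> cylinders \<Longrightarrow> measure \<nu> A = (\<Sum>i\<in>UNIV. c i * measure (Q i) A)"
    and A: "A \<in> sets path_algebra"
  shows "measure \<nu> A = (\<Sum>i\<in>UNIV. c i * measure (Q i) A)"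
proof -
  interpret \<nu>: prob_space \<nu> using \<nu> by (rule prob_space_path_law)
  note sets\<nu> = sets_path_law[OF \<nu>, unfolded sets_path_algebra]
  have QD: "prob_space (Q i)" "sets (Q i) = sigma_sets paths cylinders" "space (Q i) = paths" if "c i \<noteq> 0" for i
    using prob_space_path_law[OF Q[OF that]] sets_path_law[OF Q[OF that]] space_path_law[OF Q[OF that]]
    by (auto simp: sets_path_algebra)
  from A have "A \<in> sigma_sets paths cylinders" by (simp add: sets_path_algebra)
  with Int_stable_cylinders cylinders_subset show ?thesis
  proof (induction rule: sigma_sets_induct_disjoint)
    case (basic A)
    then show ?case by (rule eq)
  next
    case empty
    show ?case by simp
  next
    case (compl A)
    have "c i * measure (Q i) (paths - A) = c i - c i * measure (Q i) A" for i
    proof (cases "c i = 0")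
      case False
      then interpret Q: prob_space "Q i" by (rule QD)
      show ?thesis
        using Q.prob_compl[of A] QD[OF False] compl by (simp add: right_diff_distrib)
    qed simp
    then have "(\<Sum>i\<in>UNIV. c i * measure (Q i) (paths - A)) = 1 - (\<Sum>i\<in>UNIV. c i * measure (Q i) A)"
      by (simp add: sum_subtractf one)
    also have "\<dots> = measure \<nu> (paths - A)"
      using \<nu>.prob_compl[of A] compl sets\<nu> space_path_law[OF \<nu>] by simp
    finally show ?case by simp
  next
    case (union A)
    have "(\<lambda>n. c i * measure (Q i) (A n)) sums (c i * measure (Q i) (\<Union>n. A n))" for i
    proof (cases "c i = 0")
      case False
      then interpret Q: prob_space "Q i" by (rule QD)
      show ?thesis
        using union QD[OF False] by (intro sums_mult Q.finite_measure_UNION) auto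
    qed simp
    then have "(\<lambda>n. \<Sum>i\<in>UNIV. c i * measure (Q i) (A n)) sums (\<Sum>i\<in>UNIV. c i * measure (Q i) (\<Union>n. A n))"
      by (intro sums_sum)
    moreover have "(\<lambda>n. measure \<nu> (A n)) sums measure \<nu> (\<Union>n. A n)"
      using union sets\<nu> by (intro \<nu>.finite_measure_UNION) auto
    ultimately show ?case
      using union by (simp add: sums_unique2)
  qed
qed

section \<open>Decomposition into penalized limits\<close>

theorem theorem3:
  fixes \<mu> :: "'e::finite pmf"
    and W \<nu> :: "(real \<Rightarrow> 'e spider) measure"
    and f :: "'e option \<Rightarrow> real \<Rightarrow> real"
    and h :: "real \<Rightarrow> real"
  assumes "\<And>m. 0 < pmf \<mu> m"
    and "brownian_spider \<mu> junction W"
    and "path_law \<nu>"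
    and "\<nu> \<noteq> W"
    and "\<And>s. 0 \<le> s \<Longrightarrow>
           has_density_on \<nu> W (path_filtration s) (\<lambda>\<omega>. h s * f (leg (\<omega> s)) (radius (\<omega> s)))"
    and "\<And>m. C_on 2 {0..} (f (Some m))"
    and "f None 0 = 1"
    and "\<And>m. f (Some m) 0 = 1"
    and "C_on 1 {0..} h"
  shows "\<exists>\<beta>>0. (\<forall>s\<ge>0. h s = exp (- s * \<beta>\<^sup>2 / 2)) \<and>
           (\<exists>c :: 'e \<Rightarrow> real. (\<forall>m. 0 \<le> c m) \<and>
              (\<forall>\<Lambda>\<in>sets path_algebra.
                 measure \<nu> \<Lambda> =
                   (\<Sum>m\<in>UNIV. c m *
                      measure (penalized_limit W (\<lambda>m'. if m' = m then \<beta> else 0)) \<Lambda>)))"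
proof -
  define F where "F a = f (leg a) (radius a)" for a :: "'e spider"
  from \<open>C_on 1 {0..} h\<close> obtain h' where h': "\<And>s. 0 \<le> s \<Longrightarrow> (h has_real_derivative h' s) (at s within {0..})"
    by auto
  interpret spider_density \<mu> W \<nu> F h h'
  proof
    show "continuous_on UNIV (\<lambda>y. F (spoke k y))" for k
    proof -
      have "continuous_on {0..} (f (Some k))"
        using assms(6)[of k] by (auto simp: numeral_2_eq_2 continuous_on_eq_continuous_within intro: DERIV_continuous)
      then have "continuous_on UNIV (\<lambda>y. f (Some k) (max 0 y))"
        by (rule continuous_on_compose2) (auto intro!: continuous_intros)
      also have "(\<lambda>y. f (Some k) (max 0 y)) = (\<lambda>y. F (spoke k y))"
        by (auto simp: fun_eq_iff F_def leg_spoke max_def assms(7,8))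
      finally show ?thesis .
    qed
  qed (use assms h' in \<open>auto simp: F_def\<close>)
  have b: "0 < growth" using \<open>\<nu> \<noteq> W\<close> by (rule growth_pos)
  obtain w where w: "\<And>m. 0 \<le> w m" "(\<Sum>m\<in>UNIV. w m) = 1"
    "\<And>a. F a = (\<Sum>m\<in>UNIV. w m * leg_harmonic \<mu> growth m a)"
    using F_decomposition[OF b] by blast
  let ?T = "\<lambda>m s A. exp (- growth\<^sup>2 * s / 2) * (\<integral>\<omega>\<in>A. leg_harmonic \<mu> growth m (\<omega> s) \<partial>W)"
  let ?Q = "\<lambda>m. penalized_limit W (\<lambda>m'. if m' = m then growth else 0)"
  have T_nonneg: "0 \<le> ?T m s A" for m s A
    using b unfolding set_lebesgue_integral_def
    by (intro mult_nonneg_nonneg Bochner_Integration.integral_nonneg) (auto simp: leg_harmonic_nonneg)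
  have dom: "w m * ?T m s A \<le> measure \<nu> A" if "0 \<le> s" "A \<in> sets (path_filtration s)" for m s A
    unfolding measure_\<nu>[OF b w(1,3) that]
    by (rule member_le_sum[of m UNIV "\<lambda>m. w m * ?T m s A"]) (intro mult_nonneg_nonneg w(1) T_nonneg | simp)+
  \<comment> \<open>On a leg of positive weight \<open>\<nu>\<close> dominates the limit, so the limit is a path law.\<close>
  have Q: "path_law (?Q m)"
    "\<And>s A. 0 \<le> s \<Longrightarrow> A \<in> sets (path_filtration s) \<Longrightarrow> measure (?Q m) A = ?T m s A" if "w m \<noteq> 0" for m
  proof -
    have pos: "0 < w m" using w(1)[of m] that by simp
    show "path_law (?Q m)"
      by (rule path_law_penalized_limit(1)[OF W \<mu> b \<nu> pos]) (rule dom)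
    show "measure (?Q m) A = ?T m s A" if "0 \<le> s" "A \<in> sets (path_filtration s)" for s A
      by (rule path_law_penalized_limit(2)[OF W \<mu> b \<nu> pos _ that]) (rule dom)
  qed
  have "measure \<nu> A = (\<Sum>m\<in>UNIV. w m * measure (?Q m) A)" if "A \<in> sets path_algebra" for A
  proof (rule path_law_mixture[OF \<nu> Q(1) w(2) _ that])
    fix A :: "(real \<Rightarrow> 'e spider) set" assume "A \<in> cylinders"
    then obtain s where s: "0 \<le> s" "A \<in> sets (path_filtration s)" by (auto simp: cylinders_def)
    have "w m * ?T m s A = w m * measure (?Q m) A" for m
      using Q(2)[OF _ s] by (cases "w m = 0") auto
    then show "measure \<nu> A = (\<Sum>m\<in>UNIV. w m * measure (?Q m) A)"
      unfolding measure_\<nu>[OF b w(1,3) s] by (intro sum.cong refl)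
  qed auto
  moreover have "h s = exp (- s * growth\<^sup>2 / 2)" if "0 \<le> s" for s
    using h_growth[OF that] by (simp add: mult.commute)
  ultimately show ?thesis using b w(1) by blast
qed

end
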